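(* Let $G$ be a forest and $s=0$. Assume that all pieces, both in partitions and in allocations, must be pairwise disjoint (empty-intersection setting). Then for any $n\ge1$ agents with arbitrary monotone (continuous, nonnegative) valuations, a maximin allocation exists.
   Context: Cake model: the cake is a finite undirected graph $G=(V,E)$, not necessarily connected, in which every edge is a segment of positive length; points of $G$ are its vertices and the points on its edges. A piece of cake is a finite union of intervals (open, half-open or closed) contained in edges, together possibly with some vertices. A piece $X$ is connected if any two points of $X$ can be joined by a path in $G$ that stays inside $X$. There are $n$ agents $[n]$. Each agent $i$ has a valuation $v_i$ on pieces of cake that is nonnegative, monotone ($X\subseteq Y\Rightarrow v_i(X)\le v_i(Y)$) and continuous; in particular, single points have value $0$. Empty-intersection setting with $s=0$: a $k$-partition is a set of $k$ pairwise disjoint connected pieces (they need not cover $G$). An allocation is a vector $(A_1,\dots,A_n)$ of pairwise disjoint connected pieces, where $A_i$ is given to agent $i$. Maximin share: $\mathrm{MMS}_i^{k}=\sup_{\{P_1,\dots,P_k\}}\min_{j\in[k]} v_i(P_j)$, where the supremum ranges over $k$-partitions. A maximin allocation is an allocation with $v_i(A_i)\ge\mathrm{MMS}_i^{n}$ for all $i\in[n]$. *)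

theory Defs
  imports "HOL-Analysis.Analysis"
begin

text \<open>Cake model. A graph is given by a vertex set Vs, an edge set E (edge labels,
so multigraphs are allowed), endpoints ends e = (u,w) and positive lengths len e.
Points of the cake: vertices (Vx v), and interior points of edges (Ex e t, 0 < t < len e),
where t is the distance from the first endpoint.\<close>

datatype ('v,'e) cpt = Vx 'v | Ex 'e real

definition wf_graph :: "'v set \<Rightarrow> 'e set \<Rightarrow> ('e \<Rightarrow> 'v \<times> 'v) \<Rightarrow> ('e \<Rightarrow> real) \<Rightarrow> bool" where
  "wf_graph Vs E ends len \<longleftrightarrow> finite Vs \<and> finite E \<and>
     (\<forall>e\<in>E. fst (ends e) \<in> Vs \<and> snd (ends e) \<in> Vs \<and> len e > 0)"

text \<open>Position t (0 \<le> t \<le> len e) on edge e.\<close>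
definition epos :: "('e \<Rightarrow> 'v \<times> 'v) \<Rightarrow> ('e \<Rightarrow> real) \<Rightarrow> 'e \<Rightarrow> real \<Rightarrow> ('v,'e) cpt" where
  "epos ends len e t = (if t = 0 then Vx (fst (ends e))
                        else if t = len e then Vx (snd (ends e)) else Ex e t)"

definition cake_points :: "'v set \<Rightarrow> 'e set \<Rightarrow> ('e \<Rightarrow> 'v \<times> 'v) \<Rightarrow> ('e \<Rightarrow> real) \<Rightarrow> ('v,'e) cpt set" where
  "cake_points Vs E ends len = Vx ` Vs \<union> (\<Union>e\<in>E. epos ends len e ` {0..len e})"

text \<open>Forest: every edge is a bridge (its endpoints are not connected without it);
this excludes loops and cycles (including multi-edges).\<close>
definition adj_rel :: "'e set \<Rightarrow> ('e \<Rightarrow> 'v \<times> 'v) \<Rightarrow> ('v \<times> 'v) set" where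
  "adj_rel F ends = {(u, w). \<exists>e\<in>F. ends e = (u, w) \<or> ends e = (w, u)}"

definition is_forest :: "'v set \<Rightarrow> 'e set \<Rightarrow> ('e \<Rightarrow> 'v \<times> 'v) \<Rightarrow> bool" where
  "is_forest Vs E ends \<longleftrightarrow> (\<forall>e\<in>E. ends e \<notin> (adj_rel (E - {e}) ends)\<^sup>*)"

text \<open>Topology of the geometric realisation (quotient topology of the edges glued at
their endpoints, isolated vertices being isolated points).\<close>
definition cake_open :: "'v set \<Rightarrow> 'e set \<Rightarrow> ('e \<Rightarrow> 'v \<times> 'v) \<Rightarrow> ('e \<Rightarrow> real) \<Rightarrow> ('v,'e) cpt set \<Rightarrow> bool" where
  "cake_open Vs E ends len U \<longleftrightarrow> U \<subseteq> cake_points Vs E ends len \<and>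
     (\<forall>e\<in>E. openin (top_of_set {0..len e}) {t \<in> {0..len e}. epos ends len e t \<in> U})"

lemma istopology_cake_open: "istopology (cake_open Vs E ends len)"
  unfolding istopology_def
proof (intro conjI allI impI)
  fix S T assume S: "cake_open Vs E ends len S" and T: "cake_open Vs E ends len T"
  show "cake_open Vs E ends len (S \<inter> T)"
    unfolding cake_open_def
  proof (intro conjI ballI)
    show "S \<inter> T \<subseteq> cake_points Vs E ends len" using S unfolding cake_open_def by blast
  next
    fix e assume e: "e \<in> E"
    have "{t \<in> {0..len e}. epos ends len e t \<in> S \<inter> T} =
          {t \<in> {0..len e}. epos ends len e t \<in> S} \<inter> {t \<in> {0..len e}. epos ends len e t \<in> T}"
      by blast
    moreover have "openin (top_of_set {0..len e}) {t \<in> {0..len e}. epos ends len e t \<in> S}"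
      using S e unfolding cake_open_def by blast
    moreover have "openin (top_of_set {0..len e}) {t \<in> {0..len e}. epos ends len e t \<in> T}"
      using T e unfolding cake_open_def by blast
    ultimately show "openin (top_of_set {0..len e}) {t \<in> {0..len e}. epos ends len e t \<in> S \<inter> T}"
      by (simp add: openin_Int)
  qed
next
  fix K assume K: "\<forall>S\<in>K. cake_open Vs E ends len S"
  show "cake_open Vs E ends len (\<Union>K)"
    unfolding cake_open_def
  proof (intro conjI ballI)
    show "\<Union>K \<subseteq> cake_points Vs E ends len" using K unfolding cake_open_def by blast
  next
    fix e assume e: "e \<in> E"
    have "{t \<in> {0..len e}. epos ends len e t \<in> \<Union>K} =
          \<Union>((\<lambda>S. {t \<in> {0..len e}. epos ends len e t \<in> S}) ` K)"
      by blast
    moreover have "\<forall>X\<in>(\<lambda>S. {t \<in> {0..len e}. epos ends len e t \<in> S}) ` K.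
                     openin (top_of_set {0..len e}) X"
      using K e unfolding cake_open_def by blast
    ultimately show "openin (top_of_set {0..len e}) {t \<in> {0..len e}. epos ends len e t \<in> \<Union>K}"
      by (simp only: openin_Union)
  qed
qed

definition cake_top :: "'v set \<Rightarrow> 'e set \<Rightarrow> ('e \<Rightarrow> 'v \<times> 'v) \<Rightarrow> ('e \<Rightarrow> real) \<Rightarrow> ('v,'e) cpt topology" where
  "cake_top Vs E ends len = topology (cake_open Vs E ends len)"

text \<open>A piece: a finite union of intervals (open, half-open, closed; possibly degenerate)
contained in edges, together with some vertices.\<close>
definition is_piece :: "'v set \<Rightarrow> 'e set \<Rightarrow> ('e \<Rightarrow> 'v \<times> 'v) \<Rightarrow> ('e \<Rightarrow> real) \<Rightarrow> ('v,'e) cpt set \<Rightarrow> bool" where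
  "is_piece Vs E ends len X \<longleftrightarrow>
     (\<exists>F W. finite F \<and> (\<forall>(e, I)\<in>F. e \<in> E \<and> is_interval I \<and> I \<subseteq> {0..len e}) \<and> W \<subseteq> Vs \<and>
        X = (\<Union>(e, I)\<in>F. epos ends len e ` I) \<union> Vx ` W)"

text \<open>Connected piece: any two points are joined by a path in G staying inside X.\<close>
definition conn_piece :: "'v set \<Rightarrow> 'e set \<Rightarrow> ('e \<Rightarrow> 'v \<times> 'v) \<Rightarrow> ('e \<Rightarrow> real) \<Rightarrow> ('v,'e) cpt set \<Rightarrow> bool" where
  "conn_piece Vs E ends len X \<longleftrightarrow> is_piece Vs E ends len X \<and> path_connectedin (cake_top Vs E ends len) X"

text \<open>Total length (one-dimensional measure) of a set of points.\<close>
definition cake_len :: "'e set \<Rightarrow> ('e \<Rightarrow> real) \<Rightarrow> ('v,'e) cpt set \<Rightarrow> real" where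
  "cake_len E len S = (\<Sum>e\<in>E. measure lborel {t \<in> {0<..<len e}. Ex e t \<in> S})"

text \<open>Valuations: nonnegative, monotone, continuous (small change in total length of the
piece gives small change in value), single points have value 0.\<close>
definition valuation :: "'v set \<Rightarrow> 'e set \<Rightarrow> ('e \<Rightarrow> 'v \<times> 'v) \<Rightarrow> ('e \<Rightarrow> real) \<Rightarrow> (('v,'e) cpt set \<Rightarrow> real) \<Rightarrow> bool" where
  "valuation Vs E ends len v \<longleftrightarrow>
     (\<forall>X. is_piece Vs E ends len X \<longrightarrow> v X \<ge> 0) \<and>
     (\<forall>X Y. is_piece Vs E ends len X \<longrightarrow> is_piece Vs E ends len Y \<longrightarrow> X \<subseteq> Y \<longrightarrow> v X \<le> v Y) \<and>
     (\<forall>x\<in>cake_points Vs E ends len. v {x} = 0) \<and>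
     (\<forall>X \<epsilon>. is_piece Vs E ends len X \<longrightarrow> \<epsilon> > 0 \<longrightarrow>
        (\<exists>\<delta>>0. \<forall>Y. is_piece Vs E ends len Y \<longrightarrow>
            cake_len E len ((X - Y) \<union> (Y - X)) < \<delta> \<longrightarrow> \<bar>v X - v Y\<bar> < \<epsilon>))"

text \<open>k-partition (empty-intersection setting, s = 0): k pairwise disjoint connected pieces,
not necessarily covering G.\<close>
definition is_kpartition :: "'v set \<Rightarrow> 'e set \<Rightarrow> ('e \<Rightarrow> 'v \<times> 'v) \<Rightarrow> ('e \<Rightarrow> real) \<Rightarrow> nat \<Rightarrow> (nat \<Rightarrow> ('v,'e) cpt set) \<Rightarrow> bool" where
  "is_kpartition Vs E ends len k P \<longleftrightarrow>
     (\<forall>j<k. conn_piece Vs E ends len (P j)) \<and>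
     (\<forall>j<k. \<forall>j'<k. j \<noteq> j' \<longrightarrow> P j \<inter> P j' = {})"

definition MMS :: "'v set \<Rightarrow> 'e set \<Rightarrow> ('e \<Rightarrow> 'v \<times> 'v) \<Rightarrow> ('e \<Rightarrow> real) \<Rightarrow> (('v,'e) cpt set \<Rightarrow> real) \<Rightarrow> nat \<Rightarrow> real" where
  "MMS Vs E ends len v k = (SUP P \<in> {P. is_kpartition Vs E ends len k P}. Min ((\<lambda>j. v (P j)) ` {..<k}))"

text \<open>An allocation for n agents is an n-partition, A i given to agent i.\<close>
definition is_allocation :: "'v set \<Rightarrow> 'e set \<Rightarrow> ('e \<Rightarrow> 'v \<times> 'v) \<Rightarrow> ('e \<Rightarrow> real) \<Rightarrow> nat \<Rightarrow> (nat \<Rightarrow> ('v,'e) cpt set) \<Rightarrow> bool" where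
  "is_allocation Vs E ends len n A \<longleftrightarrow> is_kpartition Vs E ends len n A"

end

theory Submission
  imports Defs
begin

text \<open>
  Each agent's maximin share is attained: along a subsequence on which the end points of the pieces
  on every edge converge, the pointwise lower limits of the pieces form a partition, and the length
  of the symmetric differences tends to 0. So let agent \<open>i\<close> have a partition into \<open>n\<close>
  disjoint subtrees, each worth at least \<open>i\<close>'s share. No valuations are needed any more: one can
  pick one subtree of each agent such that the picked ones are pairwise disjoint. Indeed,
  disjoint subtrees are separated by a cut such that all subtrees crossing the cut have a common
  point; hence, as for chordal graphs, every finite family of subtrees has a simplicial member, that
  is, one such that any two members meeting it also meet each other. Give it to its owner; every
  other agent loses at most one subtree, and induction applies.
\<close>

section \<open>Intervals and subsequences\<close>

text \<open>Induction over the finite index set: a bounded real sequence has a convergent monotone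
  subsequence, and refining further keeps the limits already secured.\<close>

lemma convergent_subsequence_family:
  fixes f :: "'i \<Rightarrow> nat \<Rightarrow> real"
  assumes "finite I" "\<And>i. i \<in> I \<Longrightarrow> Bseq (f i)"
  shows "\<exists>r :: nat \<Rightarrow> nat. strict_mono r \<and> (\<forall>i\<in>I. convergent (f i \<circ> r))"
  using assms
proof (induction I)
  case empty
  then show ?case using strict_mono_id by blast
next
  case (insert i I)
  then obtain r :: "nat \<Rightarrow> nat" where r: "strict_mono r" "\<And>j. j \<in> I \<Longrightarrow> convergent (f j \<circ> r)"
    by (metis insertCI)
  obtain q :: "nat \<Rightarrow> nat" where q: "strict_mono q" "monoseq (f i \<circ> r \<circ> q)"
    using seq_monosub[of "f i \<circ> r"] by (auto simp: o_def)
  have "Bseq (f i \<circ> r \<circ> q)"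
    using insert.prems[of i] by (auto simp: Bseq_def)
  then have "convergent (f i \<circ> (r \<circ> q))"
    using q Bseq_monoseq_convergent by (metis comp_assoc)
  moreover have "convergent (f j \<circ> (r \<circ> q))" if "j \<in> I" for j
    using r(2)[OF that] q(1) convergent_subseq_convergent by (metis comp_assoc)
  moreover have "strict_mono (r \<circ> q)" using r(1) q(1) by (rule strict_mono_o)
  ultimately show ?case by blast
qed

text \<open>Holds for arbitrary \<open>A\<close>, since \<open>measure\<close> is 0 on a set that is
  not measurable; symmetric differences can thus be bounded without showing them measurable.\<close>

lemma measure_lborel_le:
  fixes A B :: "real set"
  assumes "A \<subseteq> B" "compact B"
  shows "measure lborel A \<le> measure lborel B"
proof (cases "A \<in> sets lborel")
  case True
  then show ?thesis
    using assms emeasure_compact_finite[OF assms(2)] borel_compact[OF assms(2)]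
    by (intro measure_mono_fmeasurable fmeasurableI) auto
qed (simp add: measure_notin_sets)

text \<open>The lower limit \<open>J\<close> lies between the open and the closed interval from
  \<alpha> to \<beta>. A point of the symmetric difference is in one closed interval and outside the
  other open one, hence between \<open>a k\<close> and \<alpha> or between \<open>b k\<close> and
  \<beta>.\<close>

lemma measure_interval_liminf_tendsto_0:
  fixes I :: "nat \<Rightarrow> real set"
  assumes I: "\<And>k. {a k<..<b k} \<subseteq> I k" "\<And>k. I k \<subseteq> {a k..b k}" and a: "a \<longlonglongrightarrow> \<alpha>" and b: "b \<longlonglongrightarrow> \<beta>"
  defines "J \<equiv> {t. \<forall>\<^sub>F k in sequentially. t \<in> I k}"
  shows "(\<lambda>k. measure lborel (J - I k \<union> (I k - J))) \<longlonglongrightarrow> 0"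
proof -
  have inner: "t \<in> J" if t: "\<alpha> < t" "t < \<beta>" for t
  proof -
    have "\<forall>\<^sub>F k in sequentially. a k < t" "\<forall>\<^sub>F k in sequentially. t < b k"
      using a b t by (auto dest: order_tendstoD)
    then have "\<forall>\<^sub>F k in sequentially. t \<in> I k"
      by eventually_elim (meson I(1) greaterThanLessThan_iff subsetD)
    then show ?thesis by (simp add: J_def)
  qed
  have outer: "\<alpha> \<le> t \<and> t \<le> \<beta>" if "t \<in> J" for t
  proof -
    have "\<forall>\<^sub>F k in sequentially. t \<in> I k" using that by (simp add: J_def)
    then have ab: "\<forall>\<^sub>F k in sequentially. a k \<le> t \<and> t \<le> b k"
      by eventually_elim (meson I(2) atLeastAtMost_iff subsetD)
    show ?thesis
      using tendsto_upperbound[OF a _ sequentially_bot, of t] tendsto_lowerbound[OF b _ sequentially_bot, of t] ab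
      by (simp add: eventually_conj_iff)
  qed
  have bound: "measure lborel (J - I k \<union> (I k - J)) \<le> \<bar>a k - \<alpha>\<bar> + \<bar>b k - \<beta>\<bar>" for k
  proof -
    let ?A = "{min (a k) \<alpha>..max (a k) \<alpha>}" and ?B = "{min (b k) \<beta>..max (b k) \<beta>}"
    have "t \<in> ?A \<union> ?B" if "t \<in> J - I k \<union> (I k - J)" for t
    proof -
      have "(\<alpha> \<le> t \<and> t \<le> \<beta> \<and> \<not> (a k < t \<and> t < b k)) \<or> (a k \<le> t \<and> t \<le> b k \<and> \<not> (\<alpha> < t \<and> t < \<beta>))"
        using that inner[of t] outer[of t] I[of k] by auto
      then show ?thesis by auto
    qed
    then have "J - I k \<union> (I k - J) \<subseteq> ?A \<union> ?B" by blast
    then have "measure lborel (J - I k \<union> (I k - J)) \<le> measure lborel (?A \<union> ?B)"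
      by (rule measure_lborel_le) (intro compact_Un compact_Icc)
    also have "\<dots> \<le> measure lborel ?A + measure lborel ?B"
      by (rule measure_Un_le) auto
    also have "\<dots> = \<bar>a k - \<alpha>\<bar> + \<bar>b k - \<beta>\<bar>"
      by (auto simp: min_def max_def)
    finally show ?thesis .
  qed
  have "(\<lambda>k. \<bar>a k - \<alpha>\<bar> + \<bar>b k - \<beta>\<bar>) \<longlonglongrightarrow> \<bar>\<alpha> - \<alpha>\<bar> + \<bar>\<beta> - \<beta>\<bar>"
    by (intro tendsto_intros a b)
  then have "(\<lambda>k. \<bar>a k - \<alpha>\<bar> + \<bar>b k - \<beta>\<bar>) \<longlonglongrightarrow> 0" by simp
  moreover have "\<forall>\<^sub>F k in sequentially.
      norm (measure lborel (J - I k \<union> (I k - J))) \<le> \<bar>a k - \<alpha>\<bar> + \<bar>b k - \<beta>\<bar>"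
    using bound by (intro always_eventually) simp
  ultimately show ?thesis by (rule Lim_null_comparison[rotated])
qed

section \<open>Cutting the line between two disjoint intervals\<close>

lemma disjoint_intervals_less:
  fixes I J :: "real set"
  assumes "is_interval I" "is_interval J" "I \<inter> J = {}" "a \<in> I" "b \<in> J" "a < b" "x \<in> I" "y \<in> J"
  shows "x < y"
proof (rule ccontr)
  assume "\<not> x < y"
  then have "y \<le> x" by simp
  have conv: "z \<in> K" if "is_interval K" "p \<in> K" "q \<in> K" "p \<le> z" "z \<le> q" for K and p q z :: real
    using that unfolding is_interval_1 by blast
  show False
  \<comment> \<open>An inversion forces a common point: either \<open>y\<close> lies between
    \<open>a\<close> and \<open>x\<close>, both in \<open>I\<close>, or \<open>a\<close> lies
    between \<open>y\<close> and \<open>b\<close>, both in \<open>J\<close>.\<close>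
  proof (cases "a \<le> y")
    case True
    then have "y \<in> I" using conv[OF assms(1,4,7)] \<open>y \<le> x\<close> by simp
    then show False using assms(3,8) by blast
  next
    case False
    then have "a \<in> J" using conv[OF assms(2,8,5)] assms(6) by simp
    then show False using assms(3,4) by blast
  qed
qed

text \<open>The cut is at \<open>Sup I\<close>; the two alternatives record whether the supremum
  belongs to \<open>I\<close>, so that the cut point falls on exactly one side.\<close>

lemma disjoint_intervals_cut:
  fixes I J :: "real set"
  assumes "is_interval I" "is_interval J" "I \<inter> J = {}" "a \<in> I" "b \<in> J" "a < b"
  shows "\<exists>s. (I \<subseteq> {..s} \<and> J \<subseteq> {s<..}) \<or> (I \<subseteq> {..<s} \<and> J \<subseteq> {s..})"
proof -
  have less: "x < y" if "x \<in> I" "y \<in> J" for x y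
    using disjoint_intervals_less[OF assms that] .
  have bdd: "bdd_above I" using less[OF _ assms(5)] by (intro bdd_aboveI[of _ b] less_imp_le)
  have up: "I \<subseteq> {..Sup I}" using cSup_upper[OF _ bdd] by auto
  show ?thesis
  proof (cases "Sup I \<in> I")
    case True
    then have "J \<subseteq> {Sup I<..}" using less by blast
    with up show ?thesis by (intro exI[of _ "Sup I"] disjI1 conjI)
  next
    case False
    have "I \<subseteq> {..<Sup I}"
    proof
      fix x assume "x \<in> I"
      then show "x \<in> {..<Sup I}" using up False by (cases "x = Sup I") auto
    qed
    moreover have "J \<subseteq> {Sup I..}"
    proof clarsimp
      fix y assume "y \<in> J"
      then show "Sup I \<le> y" using assms(4) less by (intro cSup_least) (auto intro: less_imp_le)
    qed
    ultimately show ?thesis by (intro exI[of _ "Sup I"] disjI2 conjI)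
  qed
qed

section \<open>Simplicial members and disjoint selections\<close>

definition crosses :: "'a set \<Rightarrow> 'a set \<Rightarrow> bool" where
  "crosses X L \<longleftrightarrow> X \<inter> L \<noteq> {} \<and> X - L \<noteq> {}"

lemma crosses_Compl [simp]: "crosses X (- L) \<longleftrightarrow> crosses X L"
  by (auto simp: crosses_def)

text \<open>In the intersection graph of the family, the members crossing \<open>L\<close> form a
  clique that separates \<open>B\<close> from \<open>C\<close>. Besides nonemptiness of the members,
  this is all that the selection uses of subtrees.\<close>

definition separable :: "'a set set \<Rightarrow> bool" where
  "separable \<C> \<longleftrightarrow> (\<forall>B\<in>\<C>. \<forall>C\<in>\<C>. B \<inter> C = {} \<longrightarrow>
     (\<exists>L. B \<subseteq> L \<and> C \<inter> L = {} \<and>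
       (\<forall>X\<in>\<C>. \<forall>Y\<in>\<C>. crosses X L \<longrightarrow> crosses Y L \<longrightarrow> X \<inter> Y \<noteq> {})))"

text \<open>The analogue of Dirac's lemma on simplicial vertices of chordal graphs: the sets crossing a
  separator form a clique.\<close>

lemma ex_simplicial_outside_clique:
  assumes "separable \<C>" "{} \<notin> \<C>" "finite F" "F \<subseteq> \<C>" "Q \<subset> F"
    and "\<And>X Y. X \<in> Q \<Longrightarrow> Y \<in> Q \<Longrightarrow> X \<inter> Y \<noteq> {}"
  shows "\<exists>A\<in>F - Q. \<forall>X\<in>F. \<forall>Y\<in>F. X \<inter> A \<noteq> {} \<longrightarrow> Y \<inter> A \<noteq> {} \<longrightarrow> X \<inter> Y \<noteq> {}"
  using assms(3-6)
proof (induction F arbitrary: Q rule: finite_psubset_induct)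
  case (psubset F)
  show ?case
  proof (cases "\<forall>X\<in>F. \<forall>Y\<in>F. X \<inter> Y \<noteq> {}")
    case True
    then show ?thesis using psubset.prems(2) by blast
  next
    case False
    then obtain B C where BC: "B \<in> F" "C \<in> F" "B \<inter> C = {}" by blast
    \<comment> \<open>Induction on the members meeting \<open>L\<close>, with the members crossing
      \<open>L\<close> as the new clique; \<open>C\<close> drops out and \<open>B\<close> lies
      outside the clique. The member found does not cross \<open>L\<close>, so it lies in
      \<open>L\<close>: it is not in \<open>Q\<close>, and everything that meets it was already
      considered.\<close>
    have side: ?thesis
      if B: "B \<in> F" "B \<subseteq> L" and C: "C \<in> F" "C \<inter> L = {}" and Q: "\<And>M. M \<in> Q \<Longrightarrow> \<not> M \<subseteq> L"
        and cross: "\<And>X Y. X \<in> F \<Longrightarrow> Y \<in> F \<Longrightarrow> crosses X L \<Longrightarrow> crosses Y L \<Longrightarrow> X \<inter> Y \<noteq> {}"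
      for B C L
    proof -
      let ?F = "{X \<in> F. X \<inter> L \<noteq> {}}" and ?Q = "{X \<in> F. crosses X L}"
      have "B \<noteq> {}" using B assms(2) psubset.prems(1) by blast
      then have "B \<in> ?F" "B \<notin> ?Q" using B by (auto simp: crosses_def)
      moreover have "?Q \<subseteq> ?F" by (auto simp: crosses_def)
      ultimately have QF: "?Q \<subset> ?F" by blast
      have FF: "?F \<subset> F" using C by blast
      have "?F \<subseteq> \<C>" using psubset.prems(1) by blast
      from psubset.IH[OF FF this QF] cross
      have "\<exists>A\<in>?F - ?Q. \<forall>X\<in>?F. \<forall>Y\<in>?F. X \<inter> A \<noteq> {} \<longrightarrow> Y \<inter> A \<noteq> {} \<longrightarrow> X \<inter> Y \<noteq> {}"
        by simp
      then obtain A where A: "A \<in> ?F - ?Q"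
        and simplicial: "\<forall>X\<in>?F. \<forall>Y\<in>?F. X \<inter> A \<noteq> {} \<longrightarrow> Y \<inter> A \<noteq> {} \<longrightarrow> X \<inter> Y \<noteq> {}"
        by (elim bexE)
      from A have AL: "A \<subseteq> L" by (auto simp: crosses_def)
      show ?thesis
      proof (intro bexI ballI impI)
        show "A \<in> F - Q" using A AL Q by blast
        fix X Y assume "X \<in> F" "Y \<in> F" and meet: "X \<inter> A \<noteq> {}" "Y \<inter> A \<noteq> {}"
        then have "X \<in> ?F" "Y \<in> ?F" using AL by blast+
        with simplicial meet show "X \<inter> Y \<noteq> {}" by blast
      qed
    qed
    obtain L where L: "B \<subseteq> L" "C \<inter> L = {}"
      and cross: "\<And>X Y. X \<in> F \<Longrightarrow> Y \<in> F \<Longrightarrow> crosses X L \<Longrightarrow> crosses Y L \<Longrightarrow> X \<inter> Y \<noteq> {}"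
      using assms(1) BC psubset.prems(1) unfolding separable_def by (meson subsetD)
    show ?thesis
    proof (cases "\<exists>M\<in>Q. M \<subseteq> L")
      case False
      show ?thesis
        by (rule side[OF BC(1) L(1) BC(2) L(2) _ cross]) (use False in blast)
    next
      case True
      have cross': "X \<inter> Y \<noteq> {}" if "X \<in> F" "Y \<in> F" "crosses X (- L)" "crosses Y (- L)" for X Y
        using cross[OF that(1,2)] that(3,4) by simp
      \<comment> \<open>Members of \<open>Q\<close> pairwise meet, so they cannot lie on both sides
        of the cut. With one inside \<open>L\<close>, the search moves to the complement, with
        \<open>B\<close> and \<open>C\<close> exchanged.\<close>
      from True have "\<not> M \<subseteq> - L" if "M \<in> Q" for M
        using psubset.prems(3) that by blast
      moreover have "C \<subseteq> - L" "B \<inter> - L = {}" using L by blast+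
      ultimately show ?thesis
        by (intro side[OF BC(2) _ BC(1) _ _ cross'])
    qed
  qed
qed

text \<open>A simplicial member is served first: it meets at most one of the pairwise disjoint sets of every
  other family.\<close>

lemma rainbow_disjoint_selection:
  assumes sep: "separable \<C>" "{} \<notin> \<C>"
  assumes "finite M" "\<And>i. i \<in> M \<Longrightarrow> finite (J i) \<and> card M \<le> card (J i)"
    and "\<And>i j. i \<in> M \<Longrightarrow> j \<in> J i \<Longrightarrow> P i j \<in> insert {} \<C>"
    and "\<And>i j j'. i \<in> M \<Longrightarrow> j \<in> J i \<Longrightarrow> j' \<in> J i \<Longrightarrow> j \<noteq> j' \<Longrightarrow> P i j \<inter> P i j' = {}"
  shows "\<exists>\<sigma>. (\<forall>i\<in>M. \<sigma> i \<in> J i) \<and> (\<forall>i\<in>M. \<forall>i'\<in>M. i \<noteq> i' \<longrightarrow> P i (\<sigma> i) \<inter> P i' (\<sigma> i') = {})"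
  using assms(3-6)
proof (induction "card M" arbitrary: M J)
  case 0
  then show ?case by simp
next
  case (Suc m)
  have J: "J i \<noteq> {}" if "i \<in> M" for i
    using Suc.prems(2)[OF that] Suc.hyps(2) by auto
  have "M \<noteq> {}" using Suc.hyps(2) by auto
  have "\<exists>i0\<in>M. \<exists>j0\<in>J i0. \<forall>i\<in>M. \<forall>j\<in>J i. \<forall>j'\<in>J i.
    P i j \<inter> P i0 j0 \<noteq> {} \<longrightarrow> P i j' \<inter> P i0 j0 \<noteq> {} \<longrightarrow> P i j \<inter> P i j' \<noteq> {}"
  \<comment> \<open>An empty set meets nothing and can be given away trivially; otherwise all sets
    belong to \<C>.\<close>
  proof (cases "\<exists>i\<in>M. \<exists>j\<in>J i. P i j = {}")
    case True
    then show ?thesis by blast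
  next
    case False
    let ?F = "\<Union>i\<in>M. P i ` J i"
    have 1: "finite ?F" using Suc.prems(1,2) by simp
    have 2: "?F \<subseteq> \<C>"
    proof clarify
      fix i j assume "i \<in> M" "j \<in> J i"
      then show "P i j \<in> \<C>" using Suc.prems(3)[of i j] False by blast
    qed
    \<comment> \<open>The empty clique excludes no member, so it only remains to know that there is
      some member.\<close>
    have 3: "{} \<subset> ?F" using J \<open>M \<noteq> {}\<close> by fastforce
    obtain A where "A \<in> ?F" and simplicial: "\<forall>X\<in>?F. \<forall>Y\<in>?F. X \<inter> A \<noteq> {} \<longrightarrow> Y \<inter> A \<noteq> {} \<longrightarrow> X \<inter> Y \<noteq> {}"
      using ex_simplicial_outside_clique[OF sep 1 2 3] by auto
    then obtain i0 j0 where i0: "i0 \<in> M" "j0 \<in> J i0" "A = P i0 j0" by blast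
    have "P i j \<inter> P i j' \<noteq> {}"
      if "i \<in> M" "j \<in> J i" "j' \<in> J i" "P i j \<inter> P i0 j0 \<noteq> {}" "P i j' \<inter> P i0 j0 \<noteq> {}" for i j j'
    proof -
      have "P i j \<in> ?F" "P i j' \<in> ?F" using that(1-3) by blast+
      then show ?thesis using simplicial that(4,5) i0(3) by blast
    qed
    then show ?thesis using i0(1,2) by (intro bexI[of _ i0] bexI[of _ j0] ballI impI)
  qed
  then obtain i0 j0 where i0: "i0 \<in> M" "j0 \<in> J i0" and
    simplicial: "\<And>i j j'. i \<in> M \<Longrightarrow> j \<in> J i \<Longrightarrow> j' \<in> J i \<Longrightarrow>
      P i j \<inter> P i0 j0 \<noteq> {} \<Longrightarrow> P i j' \<inter> P i0 j0 \<noteq> {} \<Longrightarrow> P i j \<inter> P i j' \<noteq> {}"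
    by (elim bexE) metis
  \<comment> \<open>The indices still available to \<open>i\<close> once \<open>P i0 j0\<close> is
    given away. At most one is lost while one owner leaves, so the cardinality bound
    survives.\<close>
  let ?J = "\<lambda>i. {j \<in> J i. P i j \<inter> P i0 j0 = {}}"
  have M: "m = card (M - {i0})" using Suc.hyps(2) Suc.prems(1) i0(1) by simp
  have card: "card (M - {i0}) \<le> card (?J i)" if i: "i \<in> M - {i0}" for i
  proof -
    have fin: "finite (J i)" using Suc.prems(2) i by blast
    have "\<forall>j\<in>J i - ?J i. \<forall>j'\<in>J i - ?J i. j = j'"
      using simplicial[of i] Suc.prems(4)[of i] i by blast
    then have "card (J i - ?J i) \<le> 1"
      by (simp add: card_le_Suc0_iff_eq fin)
    moreover have "card (J i - ?J i) = card (J i) - card (?J i)"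
      by (rule card_Diff_subset) (use fin in auto)
    ultimately show ?thesis
      using Suc.prems(2)[of i] Suc.hyps(2) M i by (simp del: card_Diff_insert card_Diff_singleton) arith
  qed
  have "\<exists>\<sigma>. (\<forall>i\<in>M - {i0}. \<sigma> i \<in> ?J i) \<and>
      (\<forall>i\<in>M - {i0}. \<forall>i'\<in>M - {i0}. i \<noteq> i' \<longrightarrow> P i (\<sigma> i) \<inter> P i' (\<sigma> i') = {})"
  proof (rule Suc.hyps(1)[OF M])
    show "finite (M - {i0})" using Suc.prems(1) by simp
    fix i assume i: "i \<in> M - {i0}"
    show "finite (?J i) \<and> card (M - {i0}) \<le> card (?J i)" using card[OF i] Suc.prems(2)[of i] i by simp
    fix j assume j: "j \<in> ?J i"
    show "P i j \<in> insert {} \<C>" using Suc.prems(3)[of i j] i j by simp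
    fix j' assume "j' \<in> ?J i" "j \<noteq> j'"
    then show "P i j \<inter> P i j' = {}" using Suc.prems(4)[of i j j'] i j by simp
  qed
  then obtain \<sigma> where \<sigma>: "\<forall>i\<in>M - {i0}. \<sigma> i \<in> ?J i"
    "\<forall>i\<in>M - {i0}. \<forall>i'\<in>M - {i0}. i \<noteq> i' \<longrightarrow> P i (\<sigma> i) \<inter> P i' (\<sigma> i') = {}"
    by (elim exE conjE) (rule that)
  have new: "\<sigma> i \<in> J i" "P i (\<sigma> i) \<inter> P i0 j0 = {}" if "i \<in> M" "i \<noteq> i0" for i
    using bspec[OF \<sigma>(1), of i] that by simp_all
  show ?case
  proof (intro exI[of _ "\<sigma>(i0 := j0)"] conjI ballI impI)
    fix i assume "i \<in> M"
    then show "(\<sigma>(i0 := j0)) i \<in> J i" using new(1)[of i] i0 by simp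
  next
    fix i i' assume ii': "i \<in> M" "i' \<in> M" "i \<noteq> i'"
    then consider "i = i0" "i' \<noteq> i0" | "i \<noteq> i0" "i' = i0" | "i \<noteq> i0" "i' \<noteq> i0" by blast
    then show "P i ((\<sigma>(i0 := j0)) i) \<inter> P i' ((\<sigma>(i0 := j0)) i') = {}"
    proof cases
      case 1
      then show ?thesis using new(2)[of i'] ii' by (simp add: Int_commute)
    next
      case 2
      then show ?thesis using new(2)[of i] ii' by simp
    next
      case 3
      then show ?thesis using bspec[OF bspec[OF \<sigma>(2)], of i i'] ii' by simp
    qed
  qed
qed

section \<open>Forests\<close>

lemma openin_cake_top: "openin (cake_top Vs E ends len) U \<longleftrightarrow> cake_open Vs E ends len U"
  by (simp add: cake_top_def topology_inverse' istopology_cake_open)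

lemma topspace_cake_top: "topspace (cake_top Vs E ends len) = cake_points Vs E ends len"
proof
  show "topspace (cake_top Vs E ends len) \<subseteq> cake_points Vs E ends len"
    using openin_topspace[of "cake_top Vs E ends len"] unfolding openin_cake_top cake_open_def by blast
  have "{t \<in> {0..len e}. epos ends len e t \<in> cake_points Vs E ends len} = {0..len e}" if "e \<in> E" for e
    using that by (auto simp: cake_points_def)
  then have "cake_open Vs E ends len (cake_points Vs E ends len)"
    by (simp add: cake_open_def)
  then show "cake_points Vs E ends len \<subseteq> topspace (cake_top Vs E ends len)"
    by (metis openin_cake_top openin_subset)
qed

locale cake_forest =
  fixes Vs :: "'v set" and E :: "'e set" and ends :: "'e \<Rightarrow> 'v \<times> 'v" and len :: "'e \<Rightarrow> real"
  assumes wf: "wf_graph Vs E ends len" and forest: "is_forest Vs E ends"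
begin

declare prod.collapse [simp del]

abbreviation "cake \<equiv> cake_points Vs E ends len"
abbreviation "T \<equiv> cake_top Vs E ends len"
abbreviation "pos \<equiv> epos ends len"
abbreviation "src e \<equiv> fst (ends e)"
abbreviation "tgt e \<equiv> snd (ends e)"

lemma finite_E: "finite E"
  using wf by (auto simp: wf_graph_def)

lemma len_pos: "e \<in> E \<Longrightarrow> 0 < len e"
  using wf by (auto simp: wf_graph_def)

lemma ends_in: "e \<in> E \<Longrightarrow> src e \<in> Vs" "e \<in> E \<Longrightarrow> tgt e \<in> Vs"
  using wf by (auto simp: wf_graph_def)

lemma Vx_in_cake: "Vx u \<in> cake \<longleftrightarrow> u \<in> Vs"
  using ends_in by (auto simp: cake_points_def epos_def)

lemma Ex_in_cake: "Ex e t \<in> cake \<longleftrightarrow> e \<in> E \<and> 0 < t \<and> t < len e"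
  by (auto simp: cake_points_def epos_def split: if_splits intro!: bexI[of _ e] image_eqI[of _ _ t])

lemma pos_in_cake: "e \<in> E \<Longrightarrow> 0 \<le> t \<Longrightarrow> t \<le> len e \<Longrightarrow> pos e t \<in> cake"
  unfolding cake_points_def by fastforce

subsection \<open>Bridges\<close>

definition reach :: "'e set \<Rightarrow> ('v \<times> 'v) set" where
  "reach F = (adj_rel F ends)\<^sup>*"

lemma reach_refl [simp]: "(u, u) \<in> reach F"
  by (simp add: reach_def)

lemma reach_trans: "(u, x) \<in> reach F \<Longrightarrow> (x, w) \<in> reach F \<Longrightarrow> (u, w) \<in> reach F"
  unfolding reach_def by (rule rtrancl_trans)

lemma reach_sym: "(u, w) \<in> reach F \<Longrightarrow> (w, u) \<in> reach F"
proof -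
  have "sym (adj_rel F ends)" by (auto simp: sym_def adj_rel_def)
  then show "(u, w) \<in> reach F \<Longrightarrow> (w, u) \<in> reach F"
    unfolding reach_def by (meson sym_rtrancl symD)
qed

lemma reach_cong: "(x, y) \<in> reach F \<Longrightarrow> (u, x) \<in> reach F \<longleftrightarrow> (u, y) \<in> reach F"
  by (meson reach_trans reach_sym)

lemma reach_mono: "F \<subseteq> G \<Longrightarrow> (u, w) \<in> reach F \<Longrightarrow> (u, w) \<in> reach G"
  unfolding reach_def by (rule subsetD[OF rtrancl_mono]) (auto simp: adj_rel_def)

lemma reach_edge: "f \<in> F \<Longrightarrow> (src f, tgt f) \<in> reach F"
  unfolding reach_def by (rule r_into_rtrancl) (auto simp: adj_rel_def prod.collapse)

text \<open>A walk can be shortened until it uses \<open>f\<close> at most once: in the induction, a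
  step back along \<open>f\<close> cancels the earlier crossing.\<close>

lemma reach_through_edge:
  assumes "(u, w) \<in> reach F"
  shows "(u, w) \<in> reach (F - {f})
    \<or> (u, src f) \<in> reach (F - {f}) \<and> (tgt f, w) \<in> reach (F - {f})
    \<or> (u, tgt f) \<in> reach (F - {f}) \<and> (src f, w) \<in> reach (F - {f})"
  using assms unfolding reach_def[of F]
proof (induction rule: rtrancl_induct)
  case base
  then show ?case by simp
next
  case (step y z)
  obtain g where g: "g \<in> F" "ends g = (y, z) \<or> ends g = (z, y)"
    using step.hyps by (auto simp: adj_rel_def)
  show ?case
  proof (cases "g = f")
    case True
    then have "src f = y \<and> tgt f = z \<or> src f = z \<and> tgt f = y"
      using g by auto
    then show ?thesis using step.IH by auto
  next
    case False
    then have "(y, z) \<in> reach (F - {f})"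
      unfolding reach_def by (intro r_into_rtrancl) (use g in \<open>auto simp: adj_rel_def\<close>)
    then show ?thesis using step.IH reach_trans by blast
  qed
qed

lemma bridge: "e \<in> E \<Longrightarrow> (src e, tgt e) \<notin> reach (E - {e})"
  using forest by (auto simp: is_forest_def reach_def prod.collapse)

text \<open>The side of \<open>src e\<close> when the bridge \<open>e\<close> is deleted. All other
  vertices count as the far side, including those of other components of the forest.\<close>

definition near :: "'e \<Rightarrow> 'v set" where
  "near e = {w. (src e, w) \<in> reach (E - {e})}"

lemma src_near [simp]: "src e \<in> near e"
  by (simp add: near_def)

lemma tgt_near [simp]: "e \<in> E \<Longrightarrow> tgt e \<notin> near e"
  using bridge by (simp add: near_def)

lemma near_cong: "(u, w) \<in> reach (E - {e}) \<Longrightarrow> u \<in> near e \<longleftrightarrow> w \<in> near e"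
  unfolding near_def using reach_trans reach_sym by blast

lemma near_edge: "f \<in> E \<Longrightarrow> f \<noteq> e \<Longrightarrow> tgt f \<in> near e \<longleftrightarrow> src f \<in> near e"
  using near_cong[OF reach_edge[of f "E - {e}"]] by simp

subsection \<open>Projections to the edges\<close>

text \<open>The retraction of a tree onto its edge \<open>e\<close>, as a coordinate from 0 to
  \<open>len e\<close>; other components go to \<open>len e\<close>. Both ends of an edge other than
  \<open>e\<close> are on the same side, so testing \<open>src f\<close> suffices.\<close>

fun proj :: "'e \<Rightarrow> ('v, 'e) cpt \<Rightarrow> real" where
  "proj e (Vx u) = (if u \<in> near e then 0 else len e)"
| "proj e (Ex f t) = (if f = e then t else if src f \<in> near e then 0 else len e)"

lemma proj_pos [simp]: "e \<in> E \<Longrightarrow> 0 \<le> t \<Longrightarrow> t \<le> len e \<Longrightarrow> proj e (pos e t) = t"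
  by (auto simp: epos_def)

lemma proj_pos_other: "f \<in> E \<Longrightarrow> f \<noteq> e \<Longrightarrow> proj e (pos f t) = proj e (Vx (src f))"
  by (auto simp: epos_def near_edge)

lemma proj_bounds: "e \<in> E \<Longrightarrow> x \<in> cake \<Longrightarrow> 0 \<le> proj e x \<and> proj e x \<le> len e"
  by (cases x) (auto simp: Ex_in_cake dest: len_pos)

lemma proj_inner: "e \<in> E \<Longrightarrow> 0 < proj e x \<Longrightarrow> proj e x < len e \<Longrightarrow> x = Ex e (proj e x)"
  by (cases x) (auto split: if_splits)

lemma pos_inner: "0 < s \<Longrightarrow> s < len e \<Longrightarrow> pos e s = Ex e s"
  by (auto simp: epos_def)

lemma pos_eq_iff: "e \<in> E \<Longrightarrow> 0 \<le> s \<Longrightarrow> s \<le> len e \<Longrightarrow> 0 \<le> t \<Longrightarrow> t \<le> len e \<Longrightarrow> pos e s = pos e t \<longleftrightarrow> s = t"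
  by (metis proj_pos)

text \<open>A point has finitely many coordinates on an edge: at most the two ends, or one inner
  value.\<close>

lemma openin_avoid: "openin (top_of_set {0..len f}) {t \<in> {0..len f}. pos f t \<noteq> p}"
proof -
  have "{t \<in> {0..len f}. pos f t = p} \<subseteq> {0, len f} \<union> (case p of Ex _ s \<Rightarrow> {s} | _ \<Rightarrow> {})"
    by (auto simp: epos_def split: cpt.splits)
  then have "finite {t \<in> {0..len f}. pos f t = p}"
    by (rule finite_subset) (auto split: cpt.splits)
  then have "open (- {t \<in> {0..len f}. pos f t = p})"
    by (simp add: finite_imp_closed open_Compl)
  moreover have "{t \<in> {0..len f}. pos f t \<noteq> p} = {0..len f} \<inter> - {t \<in> {0..len f}. pos f t = p}"
    by auto
  ultimately show ?thesis
    by (simp only: openin_open_Int)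
qed

section \<open>Open half-spaces and components\<close>

lemma openin_by_edges:
  assumes "U \<subseteq> cake" and "\<And>f. f \<in> E \<Longrightarrow> openin (top_of_set {0..len f}) {t \<in> {0..len f}. pos f t \<in> U}"
  shows "openin T U"
  using assms by (simp add: openin_cake_top cake_open_def)

text \<open>\<open>proj e\<close> is constant on every edge other than \<open>e\<close>, so the
  preimage there is everything or nothing; on \<open>e\<close> it is a half-line restricted to the
  edge.\<close>

lemma openin_proj_less: 
  assumes e: "e \<in> E" shows "openin T {x \<in> cake. proj e x < s}"
proof (rule openin_by_edges)
  fix f assume f: "f \<in> E"
  show "openin (top_of_set {0..len f}) {t \<in> {0..len f}. pos f t \<in> {x \<in> cake. proj e x < s}}"
  proof (cases "f = e")
    case True
    then have "{t \<in> {0..len f}. pos f t \<in> {x \<in> cake. proj e x < s}} = {0..len f} \<inter> {..<s}"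
      using f by (auto simp: pos_in_cake)
    then show ?thesis by (simp add: openin_open_Int)
  next
    case False
    then have "{t \<in> {0..len f}. pos f t \<in> {x \<in> cake. proj e x < s}}
      = (if proj e (Vx (src f)) < s then {0..len f} else {})"
      using f by (auto simp: pos_in_cake proj_pos_other simp del: proj.simps)
    then show ?thesis by simp
  qed
qed auto

lemma openin_proj_greater: 
  assumes e: "e \<in> E" shows "openin T {x \<in> cake. s < proj e x}"
proof (rule openin_by_edges)
  fix f assume f: "f \<in> E"
  show "openin (top_of_set {0..len f}) {t \<in> {0..len f}. pos f t \<in> {x \<in> cake. s < proj e x}}"
  proof (cases "f = e")
    case True
    then have "{t \<in> {0..len f}. pos f t \<in> {x \<in> cake. s < proj e x}} = {0..len f} \<inter> {s<..}"
      using f by (auto simp: pos_in_cake)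
    then show ?thesis by (simp add: openin_open_Int)
  next
    case False
    then have "{t \<in> {0..len f}. pos f t \<in> {x \<in> cake. s < proj e x}}
      = (if s < proj e (Vx (src f)) then {0..len f} else {})"
      using f by (auto simp: pos_in_cake proj_pos_other simp del: proj.simps)
    then show ?thesis by simp
  qed
qed auto

text \<open>For inner \<open>s\<close> this is just the strict half-space. At \<open>s = 0\<close>
  and \<open>s = len e\<close>, whole branches share the value \<open>s\<close>, and removing the
  single vertex \<open>pos e s\<close> is still enough for openness.\<close>

lemma openin_proj_le_minus: 
  assumes e: "e \<in> E" and s: "0 \<le> s" "s \<le> len e"
  shows "openin T {x \<in> cake. proj e x \<le> s \<and> x \<noteq> pos e s}"
proof (rule openin_by_edges)
  fix f assume f: "f \<in> E"
  show "openin (top_of_set {0..len f}) {t \<in> {0..len f}. pos f t \<in> {x \<in> cake. proj e x \<le> s \<and> x \<noteq> pos e s}}"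
  proof (cases "f = e")
    case True
    then have "{t \<in> {0..len f}. pos f t \<in> {x \<in> cake. proj e x \<le> s \<and> x \<noteq> pos e s}} = {0..len f} \<inter> {..<s}"
      using f s by (auto simp: pos_in_cake pos_eq_iff)
    then show ?thesis by (simp add: openin_open_Int)
  next
    case False
    then have "{t \<in> {0..len f}. pos f t \<in> {x \<in> cake. proj e x \<le> s \<and> x \<noteq> pos e s}}
      = (if proj e (Vx (src f)) \<le> s then {t \<in> {0..len f}. pos f t \<noteq> pos e s} else {})"
      using f by (auto simp: pos_in_cake proj_pos_other simp del: proj.simps)
    then show ?thesis using openin_avoid[of f "pos e s"] by simp
  qed
qed auto

lemma openin_proj_ge_minus: 
  assumes e: "e \<in> E" and s: "0 \<le> s" "s \<le> len e"
  shows "openin T {x \<in> cake. s \<le> proj e x \<and> x \<noteq> pos e s}"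
proof (rule openin_by_edges)
  fix f assume f: "f \<in> E"
  show "openin (top_of_set {0..len f}) {t \<in> {0..len f}. pos f t \<in> {x \<in> cake. s \<le> proj e x \<and> x \<noteq> pos e s}}"
  proof (cases "f = e")
    case True
    then have "{t \<in> {0..len f}. pos f t \<in> {x \<in> cake. s \<le> proj e x \<and> x \<noteq> pos e s}} = {0..len f} \<inter> {s<..}"
      using f s by (auto simp: pos_in_cake pos_eq_iff)
    then show ?thesis by (simp add: openin_open_Int)
  next
    case False
    then have "{t \<in> {0..len f}. pos f t \<in> {x \<in> cake. s \<le> proj e x \<and> x \<noteq> pos e s}}
      = (if s \<le> proj e (Vx (src f)) then {t \<in> {0..len f}. pos f t \<noteq> pos e s} else {})"
      using f by (auto simp: pos_in_cake proj_pos_other simp del: proj.simps)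
    then show ?thesis using openin_avoid[of f "pos e s"] by simp
  qed
qed auto

text \<open>A vertex representing the component of the point; for an inner point of an edge, either
  end would do.\<close>

fun anchor :: "('v, 'e) cpt \<Rightarrow> 'v" where
  "anchor (Vx u) = u"
| "anchor (Ex e t) = src e"

lemma anchor_pos: "e \<in> E \<Longrightarrow> (src e, anchor (pos e t)) \<in> reach E"
  by (auto simp: epos_def reach_edge)

text \<open>An edge lies in a single component, so its preimage is everything or nothing; the
  complement is open for the same reason.\<close>

lemma openin_component: "openin T {x \<in> cake. (u, anchor x) \<in> reach E}"
proof (rule openin_by_edges)
  fix f assume f: "f \<in> E"
  have "(u, anchor (pos f t)) \<in> reach E \<longleftrightarrow> (u, src f) \<in> reach E" for t
    using reach_cong[OF anchor_pos[OF f]] by simp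
  then have "{t \<in> {0..len f}. pos f t \<in> {x \<in> cake. (u, anchor x) \<in> reach E}}
      = (if (u, src f) \<in> reach E then {0..len f} else {})"
    using f by (auto simp: pos_in_cake)
  then show "openin (top_of_set {0..len f}) {t \<in> {0..len f}. pos f t \<in> {x \<in> cake. (u, anchor x) \<in> reach E}}"
    by simp
qed auto

lemma openin_co_component: "openin T {x \<in> cake. (u, anchor x) \<notin> reach E}"
proof (rule openin_by_edges)
  fix f assume f: "f \<in> E"
  have "(u, anchor (pos f t)) \<in> reach E \<longleftrightarrow> (u, src f) \<in> reach E" for t
    using reach_cong[OF anchor_pos[OF f]] by simp
  then have "{t \<in> {0..len f}. pos f t \<in> {x \<in> cake. (u, anchor x) \<notin> reach E}}
      = (if (u, src f) \<in> reach E then {} else {0..len f})"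
    using f by (auto simp: pos_in_cake)
  then show "openin (top_of_set {0..len f}) {t \<in> {0..len f}. pos f t \<in> {x \<in> cake. (u, anchor x) \<notin> reach E}}"
    by simp
qed auto

subsection \<open>Convex sets\<close>

text \<open>The one-sided weak inequalities admit the end points \<open>s = 0\<close> and \<open>s = len e\<close>, where
  \<open>pos e s\<close> is a vertex.\<close>

definition conv :: "('v, 'e) cpt set \<Rightarrow> bool" where
  "conv X \<longleftrightarrow> X \<subseteq> cake \<and>
     (\<forall>x\<in>X. \<forall>y\<in>X. (anchor x, anchor y) \<in> reach E \<and>
       (\<forall>e\<in>E. \<forall>s. proj e x \<le> s \<and> s < proj e y \<or> proj e x < s \<and> s \<le> proj e y \<longrightarrow> pos e s \<in> X))"

lemma conv_cake: "conv X \<Longrightarrow> X \<subseteq> cake"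
  by (simp add: conv_def)

lemma conv_component: "conv X \<Longrightarrow> x \<in> X \<Longrightarrow> y \<in> X \<Longrightarrow> (anchor x, anchor y) \<in> reach E"
  by (simp add: conv_def)

lemma conv_between: "conv X \<Longrightarrow> x \<in> X \<Longrightarrow> y \<in> X \<Longrightarrow> e \<in> E \<Longrightarrow>
  proj e x \<le> s \<and> s < proj e y \<or> proj e x < s \<and> s \<le> proj e y \<Longrightarrow> pos e s \<in> X"
  unfolding conv_def by blast

lemma connectedin_meets:
  assumes "connectedin T X" "openin T A" "openin T B" "A \<inter> B = {}" "x \<in> X" "x \<in> A" "y \<in> X" "y \<in> B"
  shows "\<exists>z\<in>X. z \<notin> A \<and> z \<notin> B"
proof (rule ccontr)
  assume "\<not> ?thesis"
  then have "X \<subseteq> A \<union> B" by blast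
  then show False
    using assms(1) unfolding connectedin using assms(2-) by blast
qed

text \<open>Connectedness suffices: if \<open>pos e s\<close> is missing, the two open half-spaces
  at \<open>s\<close> cover \<open>X\<close>, and points of different components are split by a
  clopen component.\<close>

lemma path_connectedin_imp_conv:
  assumes X: "path_connectedin T X"
  shows "conv X"
  unfolding conv_def
proof (intro conjI ballI allI impI)
  have con: "connectedin T X"
    using X by (rule path_connectedin_imp_connectedin)
  show sub: "X \<subseteq> cake"
    using X path_connectedin_subset_topspace topspace_cake_top by metis
  fix x y assume x: "x \<in> X" and y: "y \<in> X"
  show "(anchor x, anchor y) \<in> reach E"
  proof (rule ccontr)
    assume no: "(anchor x, anchor y) \<notin> reach E"
    have "\<exists>z\<in>X. z \<notin> {z \<in> cake. (anchor x, anchor z) \<in> reach E} \<and> z \<notin> {z \<in> cake. (anchor x, anchor z) \<notin> reach E}"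
      by (rule connectedin_meets[OF con openin_component openin_co_component, where x = x and y = y])
        (use x y no sub in auto)
    then show False using sub by auto
  qed
  fix e s assume e: "e \<in> E" and s: "proj e x \<le> s \<and> s < proj e y \<or> proj e x < s \<and> s \<le> proj e y"
  then have s01: "0 \<le> s" "s \<le> len e"
    using x y sub proj_bounds[of e x] proj_bounds[of e y] by auto
  show "pos e s \<in> X"
  proof (rule ccontr)
    assume no: "pos e s \<notin> X"
    from s show False
    proof
      assume "proj e x \<le> s \<and> s < proj e y"
      then have "\<exists>z\<in>X. z \<notin> {x \<in> cake. proj e x \<le> s \<and> x \<noteq> pos e s} \<and> z \<notin> {x \<in> cake. s < proj e x}"
        by (intro connectedin_meets[OF con openin_proj_le_minus[OF e s01] openin_proj_greater[OF e], of s x y])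
           (use x y no sub in auto)
      then show False using sub no by force
    next
      assume "proj e x < s \<and> s \<le> proj e y"
      then have "\<exists>z\<in>X. z \<notin> {x \<in> cake. s \<le> proj e x \<and> x \<noteq> pos e s} \<and> z \<notin> {x \<in> cake. proj e x < s}"
        by (intro connectedin_meets[OF con openin_proj_ge_minus[OF e s01] openin_proj_less[OF e], of s y x])
           (use x y no sub in auto)
      then show False using sub no by force
    qed
  qed
qed

section \<open>Convex sets are path-connected\<close>

lemma path_connectedin_segment:
  assumes e: "e \<in> E" and "0 \<le> a" "b \<le> len e"
  shows "path_connectedin T (pos e ` {a..b})"
proof (rule path_connectedin_continuous_map_image)
  show "continuous_map (top_of_set {0..len e}) T (pos e)"
    unfolding continuous_map_def openin_cake_top topspace_cake_top
    using e by (auto simp: cake_open_def pos_in_cake)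
  show "path_connectedin (top_of_set {0..len e}) {a..b}"
    using assms by (simp add: path_connectedin_subtopology path_connectedin_iff_path_connected_real
        is_interval_path_connected is_interval_cc)
qed

lemma path_component_segment:
  assumes "e \<in> E" "0 \<le> a" "a \<le> b" "b \<le> len e" "pos e ` {a..b} \<subseteq> X" "X \<subseteq> cake"
  shows "path_component_of (subtopology T X) (pos e a) (pos e b)"
proof -
  have "path_connectedin (subtopology T X) (pos e ` {a..b})"
    using path_connectedin_segment[of e a b] assms by (simp add: path_connectedin_subtopology)
  then show ?thesis
    using assms(3) by (intro path_component_of_maximal[THEN subsetD, simplified]) auto
qed

text \<open>\<open>f\<close> is a bridge of the whole of \<open>E\<close>, so vertices joined within
  \<open>F - {f}\<close> lie on the same side of \<open>f\<close>; the two halves of the walk lie on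
  opposite sides.\<close>

lemma bridge_separates:
  assumes "F \<subseteq> E" "f \<in> F" "(u, w) \<in> reach F" "(u, w) \<notin> reach (F - {f})"
  shows "(u, src f) \<in> reach (F - {f}) \<and> (tgt f, w) \<in> reach (F - {f})
      \<and> proj f (Vx u) = 0 \<and> proj f (Vx w) = len f
    \<or> (u, tgt f) \<in> reach (F - {f}) \<and> (src f, w) \<in> reach (F - {f})
      \<and> proj f (Vx u) = len f \<and> proj f (Vx w) = 0"
proof -
  have f: "f \<in> E" using assms by blast
  have near: "x \<in> near f \<longleftrightarrow> y \<in> near f" if "(x, y) \<in> reach (F - {f})" for x y
    using that assms(1) by (intro near_cong) (auto elim!: reach_mono[rotated])
  show ?thesis
    using reach_through_edge[OF assms(3), of f] assms(4) near[of u "src f"] near[of "tgt f" w]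
      near[of u "tgt f"] near[of "src f" w] f by auto
qed

text \<open>\<open>F\<close> is an edge set of least cardinality joining \<open>u\<close> to
  \<open>w\<close>, which stands for the tree path. Each of its edges is indispensable and hence
  separates \<open>u\<close> from \<open>w\<close>.\<close>

lemma ex_separating_edges:
  assumes "(u, w) \<in> reach E"
  obtains F where "F \<subseteq> E" "(u, w) \<in> reach F"
    "\<And>f. f \<in> F \<Longrightarrow> proj f (Vx u) = 0 \<and> proj f (Vx w) = len f \<or> proj f (Vx u) = len f \<and> proj f (Vx w) = 0"
proof -
  obtain F where F: "F \<subseteq> E" "(u, w) \<in> reach F"
    and min: "\<And>G. G \<subseteq> E \<Longrightarrow> (u, w) \<in> reach G \<Longrightarrow> card F \<le> card G"
    using ex_has_least_nat[of "\<lambda>F. F \<subseteq> E \<and> (u, w) \<in> reach F" E card] assms by blast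
  have "proj f (Vx u) = 0 \<and> proj f (Vx w) = len f \<or> proj f (Vx u) = len f \<and> proj f (Vx w) = 0"
    if f: "f \<in> F" for f
  proof -
    have "card (F - {f}) < card F"
      using f F(1) finite_E by (meson card_Diff1_less finite_subset)
    then have "(u, w) \<notin> reach (F - {f})"
      using min[of "F - {f}"] F(1) by auto
    then show ?thesis using bridge_separates[OF F(1) f F(2)] by blast
  qed
  then show ?thesis using that F by blast
qed

lemma pos_0: "pos e 0 = Vx (src e)"
  by (simp add: epos_def)

lemma pos_len: "e \<in> E \<Longrightarrow> pos e (len e) = Vx (tgt e)"
  using len_pos[of e] by (simp add: epos_def)

text \<open>An edge separating \<open>u\<close> from \<open>w\<close> has their projections at its
  two ends, so convexity puts the whole edge into \<open>X\<close>; the walk along such edges stays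
  inside.\<close>

lemma conv_path_vertices:
  assumes X: "conv X" and u: "Vx u \<in> X" and w: "Vx w \<in> X"
  shows "path_component_of (subtopology T X) (Vx u) (Vx w)"
proof -
  have "(u, w) \<in> reach E" using conv_component[OF X u w] by simp
  then obtain F where F: "F \<subseteq> E" "(u, w) \<in> reach F" and
    sep: "\<And>f. f \<in> F \<Longrightarrow> proj f (Vx u) = 0 \<and> proj f (Vx w) = len f \<or> proj f (Vx u) = len f \<and> proj f (Vx w) = 0"
    using ex_separating_edges by blast
  have edge: "path_component_of (subtopology T X) (Vx (src f)) (Vx (tgt f))" if f: "f \<in> F" for f
  proof -
    have fE: "f \<in> E" using f F by blast
    have "pos f ` {0..len f} \<subseteq> X"
    proof clarsimp
      fix s assume s: "0 \<le> s" "s \<le> len f"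
      have l: "0 < len f" using len_pos fE .
      from sep[OF f] show "pos f s \<in> X"
      proof
        assume "proj f (Vx u) = 0 \<and> proj f (Vx w) = len f"
        then show ?thesis
          using conv_between[OF X u w fE, of s] s l
          by (cases "s < len f") (auto simp del: proj.simps)
      next
        assume "proj f (Vx u) = len f \<and> proj f (Vx w) = 0"
        then show ?thesis
          using conv_between[OF X w u fE, of s] s l
          by (cases "s < len f") (auto simp del: proj.simps)
      qed
    qed
    then show ?thesis
      using path_component_segment[OF fE, of 0 "len f" X] len_pos[OF fE] conv_cake[OF X]
      by (simp add: pos_0 pos_len fE)
  qed
  show ?thesis using F(2) unfolding reach_def
  proof (induction rule: rtrancl_induct)
    case base
    then show ?case using u conv_cake[OF X] by (auto simp: path_component_of_refl topspace_cake_top)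
  next
    case (step y z)
    then obtain f where "f \<in> F" "ends f = (y, z) \<or> ends f = (z, y)"
      by (auto simp: adj_rel_def)
    then have "path_component_of (subtopology T X) (Vx y) (Vx z)"
      using edge[of f] path_component_of_sym by fastforce
    then show ?case using step.IH path_component_of_trans by metis
  qed
qed

text \<open>A point outside the interior of \<open>e\<close> projects to an end of \<open>e\<close>;
  convexity puts the segment from the inner point to that end into \<open>X\<close>.\<close>

lemma conv_path_to_vertex:
  assumes X: "conv X" and x: "Ex e t \<in> X" and y: "y \<in> X" and ne: "\<And>s. y \<noteq> Ex e s"
  shows "\<exists>u. Vx u \<in> X \<and> path_component_of (subtopology T X) (Ex e t) (Vx u)"
proof -
  have e: "e \<in> E" and t: "0 < t" "t < len e"
    using x conv_cake[OF X] Ex_in_cake by blast+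
  have pt: "pos e t = Ex e t" using t by (rule pos_inner)
  have "proj e y = 0 \<or> proj e y = len e"
    using ne by (cases y) auto
  then show ?thesis
  proof
    assume 0: "proj e y = 0"
    have "pos e ` {0..t} \<subseteq> X"
      using conv_between[OF X y x e] 0 t by force
    then show ?thesis
      using path_component_segment[OF e, of 0 t X] conv_cake[OF X] t
      by (intro exI[of _ "src e"]) (auto simp: pos_0 pt path_component_of_sym image_subset_iff dest: bspec[of _ _ 0])
  next
    assume 1: "proj e y = len e"
    have sub: "pos e ` {t..len e} \<subseteq> X"
      using conv_between[OF X x y e] 1 t by force
    then have "Vx (tgt e) \<in> X" using t by (force simp: pos_len[OF e, symmetric])
    then show ?thesis
      using path_component_segment[OF e, of t "len e" X] conv_cake[OF X] t sub
      by (intro exI[of _ "tgt e"]) (auto simp: pos_len[OF e] pt)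
  qed
qed

text \<open>Two inner points of one edge are joined by a segment; in all other cases both points
  first reach vertices of \<open>X\<close>.\<close>

lemma conv_path:
  assumes X: "conv X" and x: "x \<in> X" and y: "y \<in> X"
  shows "path_component_of (subtopology T X) x y"
proof -
  let ?R = "path_component_of (subtopology T X)"
  have refl: "?R z z" if "z \<in> X" for z
    using that conv_cake[OF X] by (auto simp add: path_component_of_refl topspace_cake_top)
  have seg: "?R (Ex e s) (Ex e t)" if "s \<le> t" "Ex e s \<in> X" "Ex e t \<in> X" for e s t
  proof (cases "s = t")
    case True
    then show ?thesis using refl that by simp
  next
    case False
    have e: "e \<in> E" "0 < s" "s < len e" "0 < t" "t < len e"
      using that conv_cake[OF X] Ex_in_cake by blast+
    have "pos e ` {s..t} \<subseteq> X"
      using conv_between[OF X that(2,3) e(1)] False by force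
    then show ?thesis
      using path_component_segment[OF e(1), of s t X] conv_cake[OF X] that e
      by (simp add: pos_inner)
  qed
  show ?thesis
  proof (cases "\<exists>e s t. x = Ex e s \<and> y = Ex e t")
    case True
    then obtain e s t where "x = Ex e s" "y = Ex e t" by blast
    then show ?thesis using seg[of s t e] seg[of t s e] x y path_component_of_sym by (metis linear)
  next
    case False
    have vertex: "\<exists>u. Vx u \<in> X \<and> ?R a (Vx u)"
      if "a \<in> X" "b \<in> X" "\<not> (\<exists>e s t. a = Ex e s \<and> b = Ex e t)" for a b
      using that refl conv_path_to_vertex[OF X _ that(2)] by (cases a) blast+
    obtain u where u: "Vx u \<in> X" "?R x (Vx u)" using vertex[OF x y] False by blast
    obtain w where w: "Vx w \<in> X" "?R y (Vx w)" using vertex[OF y x] False by blast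
    show ?thesis
      using u w conv_path_vertices[OF X u(1) w(1)] path_component_of_trans path_component_of_sym
      by metis
  qed
qed

lemma conv_imp_path_connectedin: "conv X \<Longrightarrow> path_connectedin T X"
  using conv_cake conv_path
  by (simp add: path_connectedin_def path_connected_space_iff_path_component topspace_cake_top inf_absorb2)

section \<open>Connected pieces are exactly the convex sets\<close>

text \<open>The set whose measure \<open>cake_len\<close> takes on the edge; vertices are left
  out.\<close>

definition slice :: "'e \<Rightarrow> ('v, 'e) cpt set \<Rightarrow> real set" where
  "slice e X = {t \<in> {0<..<len e}. Ex e t \<in> X}"

lemma is_interval_slice:
  assumes X: "conv X" and e: "e \<in> E"
  shows "is_interval (slice e X)"
  unfolding is_interval_1
proof (intro ballI allI impI)
  fix a b s assume a: "a \<in> slice e X" and b: "b \<in> slice e X" and s: "a \<le> s \<and> s \<le> b"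
  \<comment> \<open>\<open>conv_between\<close> needs one strict inequality; the case
    \<open>s = a\<close> is immediate.\<close>
  have "pos e s \<in> X" if "s \<noteq> a" 
    using conv_between[OF X _ _ e, of "Ex e a" "Ex e b" s] a b s that by (auto simp: slice_def)
  moreover have "0 < s" "s < len e" using a b s by (auto simp: slice_def)
  ultimately show "s \<in> slice e X" using a by (auto simp: slice_def pos_inner)
qed

lemma conv_imp_is_piece:
  assumes X: "conv X"
  shows "is_piece Vs E ends len X"
  unfolding is_piece_def
proof (intro exI conjI)
  let ?F = "(\<lambda>e. (e, slice e X)) ` E" and ?W = "{u \<in> Vs. Vx u \<in> X}"
  show "finite ?F" using finite_E by simp
  show "\<forall>(e, I)\<in>?F. e \<in> E \<and> is_interval I \<and> I \<subseteq> {0..len e}"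
    using is_interval_slice[OF X] by (auto simp: slice_def)
  show "?W \<subseteq> Vs" by blast
  show "X = (\<Union>(e, I)\<in>?F. pos e ` I) \<union> Vx ` ?W"
  proof (intro equalityI subsetI)
    fix x assume x: "x \<in> X"
    then have "x \<in> cake" using conv_cake[OF X] by blast
    then show "x \<in> (\<Union>(e, I)\<in>?F. pos e ` I) \<union> Vx ` ?W"
      using x by (cases x) (auto simp: Ex_in_cake Vx_in_cake slice_def pos_inner intro!: bexI image_eqI)
  next
    fix x assume "x \<in> (\<Union>(e, I)\<in>?F. pos e ` I) \<union> Vx ` ?W"
    then show "x \<in> X" by (auto simp: slice_def pos_inner)
  qed
qed

text \<open>From here on the topology is replaced by the coordinate conditions of
  \<open>conv\<close>; the finite description as a piece comes for free.\<close>

lemma conn_piece_iff_conv: "conn_piece Vs E ends len X \<longleftrightarrow> conv X"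
  unfolding conn_piece_def
  using conv_imp_is_piece conv_imp_path_connectedin path_connectedin_imp_conv by blast

subsection \<open>Limits of partitions\<close>

text \<open>Convexity only concerns two points at a time, and two points of the lower limit
  eventually lie in \<open>P k\<close> together.\<close>

lemma conv_liminf:
  assumes P: "\<And>k. conv (P k)"
  shows "conv {x. \<forall>\<^sub>F k in sequentially. x \<in> P k}"
proof -
  let ?L = "{x. \<forall>\<^sub>F k in sequentially. x \<in> P k}"
  have common: "\<exists>k. x \<in> P k \<and> y \<in> P k" if "x \<in> ?L" "y \<in> ?L" for x y
    using that eventually_happens'[OF sequentially_bot, of "\<lambda>k. x \<in> P k \<and> y \<in> P k"]
    by (simp add: eventually_conj_iff)
  show ?thesis
    unfolding conv_def
  proof (intro conjI ballI allI impI)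
    show "?L \<subseteq> cake" using common conv_cake[OF P] by blast
    fix x y assume xy: "x \<in> ?L" "y \<in> ?L"
    show "(anchor x, anchor y) \<in> reach E"
      using common[OF xy] conv_component[OF P] by blast
    fix e s assume "e \<in> E" "proj e x \<le> s \<and> s < proj e y \<or> proj e x < s \<and> s \<le> proj e y"
    then have "pos e s \<in> P k" if "x \<in> P k" "y \<in> P k" for k
      using conv_between[OF P that] by blast
    then show "pos e s \<in> ?L"
      using xy by (auto elim: eventually_elim2)
  qed
qed

text \<open>For an empty slice both ends are 0, so the open interval between them is empty and the
  ends stay bounded.\<close>

definition left_end :: "'e \<Rightarrow> ('v, 'e) cpt set \<Rightarrow> real" where
  "left_end e X = (if slice e X = {} then 0 else Inf (slice e X))"

definition right_end :: "'e \<Rightarrow> ('v, 'e) cpt set \<Rightarrow> real" where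
  "right_end e X = (if slice e X = {} then 0 else Sup (slice e X))"

lemma slice_bdd: "bdd_below (slice e X)" "bdd_above (slice e X)"
  by (auto simp: slice_def intro!: bdd_belowI[of _ 0] bdd_aboveI[of _ "len e"])

lemma slice_subset_ends: "slice e X \<subseteq> {left_end e X..right_end e X}"
  using slice_bdd[of e X] by (auto simp: left_end_def right_end_def intro: cInf_lower cSup_upper)

lemma ends_subset_slice:
  assumes "conv X" "e \<in> E"
  shows "{left_end e X<..<right_end e X} \<subseteq> slice e X"
proof
  fix t assume t: "t \<in> {left_end e X<..<right_end e X}"
  then have ne: "slice e X \<noteq> {}" by (auto simp: left_end_def right_end_def)
  then obtain x y where "x \<in> slice e X" "x < t" "y \<in> slice e X" "t < y"
    using t slice_bdd by (auto simp: left_end_def right_end_def cInf_less_iff less_cSup_iff)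
  then show "t \<in> slice e X"
    using is_interval_slice[OF assms] unfolding is_interval_1 by (meson less_imp_le)
qed

lemma ends_bounds:
  assumes "e \<in> E"
  shows "\<bar>left_end e X\<bar> \<le> len e" "\<bar>right_end e X\<bar> \<le> len e"
proof -
  have "left_end e X = 0 \<and> right_end e X = 0
    \<or> 0 \<le> left_end e X \<and> left_end e X \<le> right_end e X \<and> right_end e X \<le> len e"
  proof (cases "slice e X = {}")
    case False
    then obtain x where "x \<in> slice e X" by blast
    then have "left_end e X \<le> right_end e X" using slice_subset_ends[of e X] by force
    moreover have "0 \<le> left_end e X" "right_end e X \<le> len e"
      using False by (auto simp: left_end_def right_end_def slice_def intro!: cInf_greatest cSup_least)
    ultimately show ?thesis by simp
  qed (simp add: left_end_def right_end_def)
  then show "\<bar>left_end e X\<bar> \<le> len e" "\<bar>right_end e X\<bar> \<le> len e"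
    using len_pos[OF assms] by auto
qed

text \<open>Along a suitable subsequence the limit pieces can be taken to be pointwise lower limits:
  these inherit disjointness and convexity for free, and the vertices do not matter for the length.\<close>

lemma kpartition_limit:
  assumes P: "\<And>k. is_kpartition Vs E ends len n (P k)"
  obtains r :: "nat \<Rightarrow> nat" and L where "strict_mono r" "is_kpartition Vs E ends len n L"
    "\<And>v j. valuation Vs E ends len v \<Longrightarrow> j < n \<Longrightarrow> (\<lambda>k. v (P (r k) j)) \<longlonglongrightarrow> v (L j)"
proof -
  have cP: "conv (P k j)" if "j < n" for k j
    using P that by (simp add: is_kpartition_def conn_piece_iff_conv)
  \<comment> \<open>One bounded real sequence for each piece, edge and side: a finite
    family.\<close>
  let ?f = "\<lambda>(j, e, left) k. if left then left_end e (P k j) else right_end e (P k j)"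
  have "\<exists>r :: nat \<Rightarrow> nat. strict_mono r \<and> (\<forall>i\<in>{..<n} \<times> E \<times> UNIV. convergent (?f i \<circ> r))"
  proof (rule convergent_subsequence_family)
    show "finite ({..<n} \<times> E \<times> (UNIV :: bool set))" using finite_E by simp
    show "Bseq (?f i)" if "i \<in> {..<n} \<times> E \<times> UNIV" for i
      using that ends_bounds len_pos by (auto intro!: BseqI'[of _ "len (fst (snd i))"])
  qed
  then obtain r :: "nat \<Rightarrow> nat" where r: "strict_mono r"
    and cvg: "\<And>i. i \<in> {..<n} \<times> E \<times> UNIV \<Longrightarrow> convergent (?f i \<circ> r)"
    by blast
  define L where "L j = {x. \<forall>\<^sub>F k in sequentially. x \<in> P (r k) j}" for j
  have cL: "conv (L j)" if "j < n" for j
    unfolding L_def using cP that by (intro conv_liminf) auto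
  have "is_kpartition Vs E ends len n L"
    unfolding is_kpartition_def
  proof (intro conjI allI impI)
    fix j assume j: "j < n"
    show "conn_piece Vs E ends len (L j)" using cL[OF j] by (simp add: conn_piece_iff_conv)
    fix j' assume j': "j' < n" "j \<noteq> j'"
    show "L j \<inter> L j' = {}"
    proof (rule ccontr)
      assume "L j \<inter> L j' \<noteq> {}"
      then obtain x where "\<forall>\<^sub>F k in sequentially. x \<in> P (r k) j \<and> x \<in> P (r k) j'"
        by (auto simp: L_def eventually_conj_iff)
      then obtain k where "x \<in> P (r k) j" "x \<in> P (r k) j'"
        using eventually_happens'[OF sequentially_bot] by blast
      then show False using P[of "r k"] j j' by (auto simp: is_kpartition_def)
    qed
  qed
  moreover have "(\<lambda>k. v (P (r k) j)) \<longlonglongrightarrow> v (L j)" if v: "valuation Vs E ends len v" and j: "j < n" for v j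
  proof -
    let ?D = "\<lambda>k. (L j - P (r k) j) \<union> (P (r k) j - L j)"
    have "(\<lambda>k. measure lborel {t \<in> {0<..<len e}. Ex e t \<in> ?D k}) \<longlonglongrightarrow> 0" if e: "e \<in> E" for e
    proof -
      obtain \<alpha> where \<alpha>: "(\<lambda>k. left_end e (P (r k) j)) \<longlonglongrightarrow> \<alpha>"
        using cvg[of "(j, e, True)"] j e by (auto simp: convergent_def o_def)
      obtain \<beta> where \<beta>: "(\<lambda>k. right_end e (P (r k) j)) \<longlonglongrightarrow> \<beta>"
        using cvg[of "(j, e, False)"] j e by (auto simp: convergent_def o_def)
      \<comment> \<open>Slicing commutes with lower limits, so the one-dimensional estimate applies
        on each edge.\<close>
      have L: "{t. \<forall>\<^sub>F k in sequentially. t \<in> slice e (P (r k) j)} = slice e (L j)"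
        by (auto simp: slice_def L_def eventually_conj_iff)
      have "(\<lambda>k. measure lborel (slice e (L j) - slice e (P (r k) j) \<union> (slice e (P (r k) j) - slice e (L j)))) \<longlonglongrightarrow> 0"
        using measure_interval_liminf_tendsto_0[OF ends_subset_slice[OF cP[OF j] e] slice_subset_ends \<alpha> \<beta>]
        unfolding L .
      moreover have "slice e (L j) - slice e (P (r k) j) \<union> (slice e (P (r k) j) - slice e (L j))
        = {t \<in> {0<..<len e}. Ex e t \<in> ?D k}" for k
        by (auto simp: slice_def)
      ultimately show ?thesis by simp
    qed
    then have "(\<lambda>k. cake_len E len (?D k)) \<longlonglongrightarrow> 0"
      unfolding cake_len_def by (rule tendsto_null_sum)
    then have small: "\<forall>\<^sub>F k in sequentially. cake_len E len (?D k) < \<delta>" if "\<delta> > 0" for \<delta>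
      using that by (auto dest: order_tendstoD)
    show ?thesis
    proof (rule tendstoI)
      fix \<epsilon> :: real assume "\<epsilon> > 0"
      then obtain \<delta> where \<delta>: "\<delta> > 0" "\<And>Y. is_piece Vs E ends len Y \<Longrightarrow>
          cake_len E len ((L j - Y) \<union> (Y - L j)) < \<delta> \<Longrightarrow> \<bar>v (L j) - v Y\<bar> < \<epsilon>"
        using v conv_imp_is_piece[OF cL[OF j]] unfolding valuation_def by meson
      show "\<forall>\<^sub>F k in sequentially. dist (v (P (r k) j)) (v (L j)) < \<epsilon>"
        using small[OF \<delta>(1)]
      proof eventually_elim
        case (elim k)
        then show ?case
          using \<delta>(2)[OF conv_imp_is_piece[OF cP[OF j]]] by (simp add: dist_real_def abs_minus_commute)
      qed
    qed
  qed
  ultimately show ?thesis using that r by blast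
qed

section \<open>Attainment of the maximin share\<close>

lemma is_piece_cake: "is_piece Vs E ends len cake"
  unfolding is_piece_def
proof (intro exI conjI)
  let ?F = "(\<lambda>e. (e, {0..len e})) ` E"
  show "finite ?F" using finite_E by simp
  show "\<forall>(e, I)\<in>?F. e \<in> E \<and> is_interval I \<and> I \<subseteq> {0..len e}"
    by (auto simp: is_interval_cc)
  show "cake = (\<Union>(e, I)\<in>?F. pos e ` I) \<union> Vx ` Vs"
    unfolding cake_points_def by auto
qed simp

text \<open>Partitions within \<open>1 / real (Suc k)\<close> of the supremum have a limit
  partition, and the inequality for each piece passes to the limit.\<close>

lemma MMS_attained:
  assumes v: "valuation Vs E ends len v" and n: "n \<ge> 1"
  shows "\<exists>P. is_kpartition Vs E ends len n P \<and> (\<forall>j<n. MMS Vs E ends len v n \<le> v (P j))"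
proof -
  let ?K = "{P. is_kpartition Vs E ends len n P}"
  let ?g = "\<lambda>P :: nat \<Rightarrow> ('v, 'e) cpt set. Min ((\<lambda>j. v (P j)) ` {..<n})"
  \<comment> \<open>Empty pieces are allowed, so the supremum ranges over a nonempty set.\<close>
  have "conv {}" by (simp add: conv_def)
  then have ne: "?K \<noteq> {}"
    by (auto simp: is_kpartition_def conn_piece_iff_conv intro!: exI[of _ "\<lambda>_. {}"])
  have "?g P \<le> v cake" if P: "P \<in> ?K" for P
  proof -
    have c: "conv (P 0)" using P n by (simp add: is_kpartition_def conn_piece_iff_conv)
    have "?g P \<le> v (P 0)" using n by (intro Min_le) auto
    also have "\<dots> \<le> v cake"
      using v conv_imp_is_piece[OF c] is_piece_cake conv_cake[OF c] unfolding valuation_def by blast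
    finally show ?thesis .
  qed
  then have bdd: "bdd_above (?g ` ?K)" by (intro bdd_aboveI[of _ "v cake"]) auto
  have "\<exists>P. is_kpartition Vs E ends len n P \<and> (\<forall>j<n. MMS Vs E ends len v n - 1 / real (Suc k) < v (P j))" for k
  proof -
    have "MMS Vs E ends len v n - 1 / real (Suc k) < (SUP P\<in>?K. ?g P)"
      unfolding MMS_def by simp
    then obtain P where P: "P \<in> ?K" "MMS Vs E ends len v n - 1 / real (Suc k) < ?g P"
      using less_cSUP_iff[OF ne bdd] by blast
    then have "MMS Vs E ends len v n - 1 / real (Suc k) < v (P j)" if "j < n" for j
      using that n by (subst (asm) Min_gr_iff) auto
    then show ?thesis using P(1) by blast
  qed
  then obtain P where P: "\<And>k. is_kpartition Vs E ends len n (P k)"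
    "\<And>k j. j < n \<Longrightarrow> MMS Vs E ends len v n - 1 / real (Suc k) < v (P k j)"
    by metis
  obtain r L where r: "strict_mono r" and L: "is_kpartition Vs E ends len n L"
    and lim: "\<And>w j. valuation Vs E ends len w \<Longrightarrow> j < n \<Longrightarrow> (\<lambda>k. w (P (r k) j)) \<longlonglongrightarrow> w (L j)"
    using kpartition_limit[of n P] P(1) by blast
  have "MMS Vs E ends len v n \<le> v (L j)" if j: "j < n" for j
  proof (rule LIMSEQ_le[OF _ lim[OF v j]])
    have "(\<lambda>k. 1 / real (Suc k)) \<longlonglongrightarrow> 0"
      by (rule LIMSEQ_Suc[OF lim_1_over_n])
    then have "((\<lambda>k. 1 / real (Suc k)) \<circ> r) \<longlonglongrightarrow> 0"
      using r by (rule LIMSEQ_subseq_LIMSEQ)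
    from tendsto_diff[OF tendsto_const this]
    show "(\<lambda>k. MMS Vs E ends len v n - 1 / real (Suc (r k))) \<longlonglongrightarrow> MMS Vs E ends len v n"
      by (simp add: o_def)
    show "\<exists>N. \<forall>k\<ge>N. MMS Vs E ends len v n - 1 / real (Suc (r k)) \<le> v (P (r k) j)"
      using P(2)[OF j] less_imp_le by blast
  qed
  then show ?thesis using L by blast
qed

subsection \<open>Separation of disjoint pieces\<close>

text \<open>\<open>B\<close> cannot project to \<open>len e\<close>, since convexity from
  \<open>u\<close> would put \<open>tgt e\<close> into it; likewise \<open>C\<close> cannot project
  to 0. A common value would therefore be inner, where it determines the point.\<close>

lemma disjoint_proj_if_vertices:
  assumes e: "e \<in> E" and B: "conv B" and C: "conv C" and u: "Vx u \<in> B" and w: "Vx w \<in> C"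
    and "proj e (Vx u) = 0" "proj e (Vx w) = len e" "Vx (tgt e) \<notin> B" "Vx (src e) \<notin> C" "B \<inter> C = {}"
  shows "proj e ` B \<inter> proj e ` C = {}"
proof (rule ccontr)
  assume "proj e ` B \<inter> proj e ` C \<noteq> {}"
  then obtain x y where x: "x \<in> B" and y: "y \<in> C" and eq: "proj e x = proj e y" by auto
  have l: "0 < len e" using e by (rule len_pos)
  have "0 \<le> proj e x" "proj e x \<le> len e" using proj_bounds[OF e] x conv_cake[OF B] by auto
  moreover have "proj e x \<noteq> len e"
    using conv_between[OF B u x e, of "len e"] assms(6,8) l by (auto simp: pos_len[OF e] simp del: proj.simps)
  moreover have "proj e y \<noteq> 0"
    using conv_between[OF C y w e, of 0] assms(7,9) l by (auto simp: pos_0 simp del: proj.simps)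
  ultimately have "x = y"
    using proj_inner[OF e, of x] proj_inner[OF e, of y] eq by auto
  then show False using x y assms(10) by blast
qed

text \<open>Such a \<open>B\<close> lies in the interior of the edge of \<open>b\<close>, and an
  inner value of \<open>proj e\<close> has only one preimage in the whole cake.\<close>

lemma disjoint_proj_if_no_vertex:
  assumes B: "conv B" and b: "b \<in> B" and no: "\<And>u. Vx u \<notin> B" and dis: "B \<inter> C = {}"
  shows "\<exists>e\<in>E. proj e ` B \<inter> proj e ` C = {}"
proof -
  obtain e t where et: "b = Ex e t" using no b by (cases b) auto
  have e: "e \<in> E" and t: "0 < t" "t < len e"
    using b conv_cake[OF B] et Ex_in_cake by blast+
  have inner: "0 < proj e x \<and> proj e x < len e" if x: "x \<in> B" for x
  proof -
    have "proj e x \<noteq> 0"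
      using conv_between[OF B x b e, of 0] no t et by (auto simp: pos_0)
    moreover have "proj e x \<noteq> len e"
      using conv_between[OF B b x e, of "len e"] no t et by (auto simp: pos_len[OF e])
    ultimately show ?thesis using proj_bounds[OF e, of x] x conv_cake[OF B] by force
  qed
  have "x = y" if "x \<in> B" "proj e x = proj e y" for x y
    using proj_inner[OF e, of x] proj_inner[OF e, of y] inner[OF that(1)] that(2) by auto
  then have "proj e ` B \<inter> proj e ` C = {}" using dis by blast
  then show ?thesis using e by blast
qed

text \<open>If both sets contain vertices, a shortest connection between them is taken: each of its
  edges leads from the side of \<open>B\<close> to that of \<open>C\<close>, so any one will
  do.\<close>

lemma ex_disjoint_proj:
  assumes B: "conv B" and C: "conv C" and b: "b \<in> B" and c: "c \<in> C" and dis: "B \<inter> C = {}"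
    and bc: "(anchor b, anchor c) \<in> reach E"
  shows "\<exists>e\<in>E. proj e ` B \<inter> proj e ` C = {}"
proof (cases "(\<exists>u. Vx u \<in> B) \<and> (\<exists>w. Vx w \<in> C)")
  case False
  then show ?thesis
    using disjoint_proj_if_no_vertex[OF B b _ dis] disjoint_proj_if_no_vertex[OF C c, of B] dis
    by (metis Int_commute)
next
  case True
  \<comment> \<open>The minimum is taken over the two end vertices together with the edge
    set.\<close>
  let ?ok = "\<lambda>(u, w, F). Vx u \<in> B \<and> Vx w \<in> C \<and> F \<subseteq> E \<and> (u, w) \<in> reach F"
  obtain u0 w0 where uw0: "Vx u0 \<in> B" "Vx w0 \<in> C" using True by blast
  then have "(u0, anchor b) \<in> reach E" "(anchor c, w0) \<in> reach E"
    using conv_component[OF B _ b] conv_component[OF C c] by force+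
  then have "?ok (u0, w0, E)" using uw0 bc reach_trans by blast
  from ex_has_least_nat[of ?ok, OF this, of "\<lambda>(u, w, F). card F"]
  obtain u w F where u: "Vx u \<in> B" and w: "Vx w \<in> C" and F: "F \<subseteq> E" "(u, w) \<in> reach F"
    and min: "\<And>u' w' G. Vx u' \<in> B \<Longrightarrow> Vx w' \<in> C \<Longrightarrow> G \<subseteq> E \<Longrightarrow> (u', w') \<in> reach G \<Longrightarrow> card F \<le> card G"
    by (fastforce split: prod.splits)
  have "F \<noteq> {}"
  proof
    assume "F = {}"
    then have "u = w" using F(2) by (auto simp: reach_def adj_rel_def)
    then show False using u w dis by blast
  qed
  then obtain f where f: "f \<in> F" by blast
  then have fE: "f \<in> E" using F(1) by blast
  have "card (F - {f}) < card F"
    using f F(1) finite_E by (meson card_Diff1_less finite_subset)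
  then have min': "(u', w') \<notin> reach (F - {f})" if "Vx u' \<in> B" "Vx w' \<in> C" for u' w'
    using min[OF that, of "F - {f}"] F(1) by auto
  from bridge_separates[OF F(1) f F(2) min'[OF u w]]
  have "proj f ` B \<inter> proj f ` C = {}"
  proof (elim disjE conjE)
    assume "(u, src f) \<in> reach (F - {f})" "(tgt f, w) \<in> reach (F - {f})"
      and p: "proj f (Vx u) = 0" "proj f (Vx w) = len f"
    \<comment> \<open>Otherwise \<open>tgt f\<close> could replace \<open>u\<close>, or
      \<open>src f\<close> could replace \<open>w\<close>, and \<open>F - {f}\<close> would be a
      smaller connection.\<close>
    then have "Vx (tgt f) \<notin> B" "Vx (src f) \<notin> C" using min' u w by blast+
    then show ?thesis using disjoint_proj_if_vertices[OF fE B C u w p] dis by blast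
  next
    assume "(u, tgt f) \<in> reach (F - {f})" "(src f, w) \<in> reach (F - {f})"
      and p: "proj f (Vx u) = len f" "proj f (Vx w) = 0"
    then have "Vx (src f) \<notin> B" "Vx (tgt f) \<notin> C" using min' u w by blast+
    then show ?thesis using disjoint_proj_if_vertices[OF fE C B w u p(2,1)] dis by blast
  qed
  then show ?thesis using fE by blast
qed

lemma is_interval_proj:
  assumes X: "conv X" and e: "e \<in> E"
  shows "is_interval (proj e ` X)"
  unfolding is_interval_1
proof (intro ballI allI impI)
  fix a b s assume "a \<in> proj e ` X" "b \<in> proj e ` X" and s: "a \<le> s \<and> s \<le> b"
  then obtain x y where x: "x \<in> X" "a = proj e x" and y: "y \<in> X" "b = proj e y" by blast
  show "s \<in> proj e ` X"
  proof (cases "s = a")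
    case False
    then have "pos e s \<in> X" using conv_between[OF X x(1) y(1) e, of s] x y s by auto
    moreover have "0 \<le> s" "s \<le> len e"
      using proj_bounds[OF e, of x] proj_bounds[OF e, of y] x y s conv_cake[OF X] by auto
    ultimately show ?thesis using e by (metis proj_pos imageI)
  qed (use x in simp)
qed

text \<open>Sets in different components are separated by a component, which no convex set crosses.
  Within a component the cut is a half-space of some \<open>proj e\<close>, and every convex set
  crossing it contains the cut point.\<close>

lemma separable_conv: "separable {X. conv X \<and> X \<noteq> {}}"
proof -
  let ?\<C> = "{X. conv X \<and> X \<noteq> {}}"
  let ?sep = "\<lambda>L. \<forall>X\<in>?\<C>. \<forall>Y\<in>?\<C>. crosses X L \<longrightarrow> crosses Y L \<longrightarrow> X \<inter> Y \<noteq> {}"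
  have cut: "\<exists>L. B \<subseteq> L \<and> C \<inter> L = {} \<and> ?sep L"
    if e: "e \<in> E" and B: "conv B" and C: "conv C" and d: "proj e ` B \<inter> proj e ` C = {}"
      and bc: "b \<in> B" "c \<in> C" "proj e b < proj e c" for e B C b c
  proof -
    have "\<exists>s L. B \<subseteq> L \<and> C \<inter> L = {} \<and> (L = {x. proj e x \<le> s} \<or> L = {x. proj e x < s})"
    proof -
      obtain s where "(proj e ` B \<subseteq> {..s} \<and> proj e ` C \<subseteq> {s<..}) \<or> (proj e ` B \<subseteq> {..<s} \<and> proj e ` C \<subseteq> {s..})"
        using disjoint_intervals_cut[OF is_interval_proj[OF B e] is_interval_proj[OF C e] d imageI imageI, OF bc] by blast
      then have "B \<subseteq> {x. proj e x \<le> s} \<and> C \<inter> {x. proj e x \<le> s} = {}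
          \<or> B \<subseteq> {x. proj e x < s} \<and> C \<inter> {x. proj e x < s} = {}"
        by (simp add: image_subset_iff disjoint_iff subset_eq not_le not_less) blast
      then show ?thesis by metis
    qed
    then obtain s L where L: "B \<subseteq> L" "C \<inter> L = {}" "L = {x. proj e x \<le> s} \<or> L = {x. proj e x < s}"
      by (elim exE conjE) (rule that)
    \<comment> \<open>One side of the cut is strict and the other weak, which matches the two
      alternatives in \<open>conv\<close>; the cut point may thus be a vertex.\<close>
    have through: "pos e s \<in> X" if X: "conv X" and cr: "crosses X L" for X
    proof -
      obtain x y where "x \<in> X" "x \<in> L" "y \<in> X" "y \<notin> L" using cr unfolding crosses_def by blast
      then show ?thesis using conv_between[OF X \<open>x \<in> X\<close> \<open>y \<in> X\<close> e, of s] L(3) by auto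
    qed
    have "?sep L"
    proof (intro ballI impI)
      fix X Y assume "X \<in> ?\<C>" "Y \<in> ?\<C>" "crosses X L" "crosses Y L"
      then have "pos e s \<in> X" "pos e s \<in> Y" using through by simp_all
      then show "X \<inter> Y \<noteq> {}" by blast
    qed
    then show ?thesis using L(1,2) by (intro exI[of _ L] conjI)
  qed
  show ?thesis
    unfolding separable_def
  proof (intro ballI impI)
    fix B C assume "B \<in> ?\<C>" "C \<in> ?\<C>" and dis: "B \<inter> C = {}"
    then obtain b c where B: "conv B" "b \<in> B" and C: "conv C" "c \<in> C" by blast
    show "\<exists>L. B \<subseteq> L \<and> C \<inter> L = {} \<and> ?sep L"
    proof (cases "(anchor b, anchor c) \<in> reach E")
      case False
      let ?L = "{x. (anchor b, anchor x) \<in> reach E}"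
      have "B \<subseteq> ?L" using conv_component[OF B] by blast
      moreover have "C \<inter> ?L = {}"
        using conv_component[OF C(1) _ C(2)] False reach_trans by blast
      moreover have "\<not> crosses X ?L" if "conv X" for X
        using conv_component[OF that] reach_trans unfolding crosses_def by blast
      ultimately show ?thesis by (intro exI[of _ ?L]) simp
    next
      case True
      obtain e where e: "e \<in> E" and d: "proj e ` B \<inter> proj e ` C = {}"
        using ex_disjoint_proj[OF B(1) C(1) B(2) C(2) dis True] by (elim bexE)
      have "proj e b \<noteq> proj e c" using d B C by blast
      then consider "proj e b < proj e c" | "proj e c < proj e b" by linarith
      then show ?thesis
      proof cases
        case 1
        then show ?thesis using cut[OF e B(1) C(1) d B(2) C(2)] by simp
      next
        case 2
        \<comment> \<open>The half-space found contains \<open>C\<close>, so its complement serves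
          as the cut for \<open>B\<close>.\<close>
        from d have "proj e ` C \<inter> proj e ` B = {}" by (simp add: Int_commute)
        from cut[OF e C(1) B(1) this C(2) B(2) 2]
        obtain L where "C \<subseteq> L" "B \<inter> L = {}" "?sep L" by (elim exE conjE)
        then show ?thesis
          by (intro exI[of _ "- L"] conjI) (simp_all only: crosses_Compl, blast+)
      qed
    qed
  qed
qed

end

theorem theorem1:
  fixes Vs :: "'v set" and E :: "'e set" and ends :: "'e \<Rightarrow> 'v \<times> 'v" and len :: "'e \<Rightarrow> real"
    and n :: nat and v :: "nat \<Rightarrow> ('v,'e) cpt set \<Rightarrow> real"
  assumes "wf_graph Vs E ends len"
    and "is_forest Vs E ends"
    and "n \<ge> 1"
    and "\<forall>i<n. valuation Vs E ends len (v i)"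
  shows "\<exists>A. is_allocation Vs E ends len n A \<and>
             (\<forall>i<n. v i (A i) \<ge> MMS Vs E ends len (v i) n)"
proof -
  interpret cake_forest Vs E ends len
    using assms(1,2) by unfold_locales
  have "\<forall>i<n. \<exists>P. is_kpartition Vs E ends len n P \<and> (\<forall>j<n. MMS Vs E ends len (v i) n \<le> v i (P j))"
    using MMS_attained assms(3,4) by blast
  then obtain P where P: "\<And>i. i < n \<Longrightarrow> is_kpartition Vs E ends len n (P i)"
    "\<And>i j. i < n \<Longrightarrow> j < n \<Longrightarrow> MMS Vs E ends len (v i) n \<le> v i (P i j)"
    by metis
  \<comment> \<open>There are \<open>n\<close> agents with \<open>n\<close> pieces each, so the
    cardinality hypothesis holds with equality; \<sigma> picks one of each agent's own pieces, each
    worth at least that agent's share.\<close>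
  have "\<exists>\<sigma>. (\<forall>i\<in>{..<n}. \<sigma> i \<in> {..<n}) \<and>
      (\<forall>i\<in>{..<n}. \<forall>i'\<in>{..<n}. i \<noteq> i' \<longrightarrow> P i (\<sigma> i) \<inter> P i' (\<sigma> i') = {})"
    using P(1) by (intro rainbow_disjoint_selection[OF separable_conv])
      (auto simp: is_kpartition_def conn_piece_iff_conv)
  then obtain \<sigma> where "\<forall>i\<in>{..<n}. \<sigma> i \<in> {..<n}"
    and dis: "\<forall>i\<in>{..<n}. \<forall>i'\<in>{..<n}. i \<noteq> i' \<longrightarrow> P i (\<sigma> i) \<inter> P i' (\<sigma> i') = {}"
    by (elim exE conjE)
  then have \<sigma>: "\<sigma> i < n" if "i < n" for i using that by blast
  show ?thesis
  proof (intro exI[of _ "\<lambda>i. P i (\<sigma> i)"] conjI allI impI)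
    show "is_allocation Vs E ends len n (\<lambda>i. P i (\<sigma> i))"
      using P(1) \<sigma> dis by (simp add: is_allocation_def is_kpartition_def)
    show "MMS Vs E ends len (v i) n \<le> v i (P i (\<sigma> i))" if "i < n" for i
      using P(2) \<sigma> that by blast
  qed
qed

end
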